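(* (i) Let $\lambda\in\mathbb{R}$ be fixed and $p=p(n)=(1+\lambda n^{-1/3})/n$. There exist constants $A_0=A_0(\lambda)>0$ and $c>0$ such that, for any $A=A(n)$ with $A_0\le A=o(n^{2/3})$ and for all sufficiently large $n$, \[\mathbb{P}\big(|\mathcal{C}_{\max}(\mathbb{G}(n,p))|<n^{2/3}/A\big)\le \exp\big(-cA^{3/2}\big).\] (ii) Let $\lambda\in\mathbb{R}$ and an integer $d\ge 3$ be fixed and let $p=p(d,n)=(1+\lambda n^{-1/3})/(d-1)$. There exist constants $A_0=A_0(\lambda,d)>0$ and $c=c(d)>0$ such that, for any $A=A(n)$ with $A_0\le A=O(n^{1/6})$ and for all sufficiently large $n$ with $dn$ even, \[\mathbb{P}\big(|\mathcal{C}_{\max}(\mathbb{G}(n,d,p))|<n^{2/3}/A\big)\le \exp\big(-cA^{3/2}\big).\]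
   Context: $\mathbb{G}(n,p)$ is the Erdős–Rényi random graph on vertex set $[n]=\{1,\dots,n\}$, in which each of the $\binom n2$ possible edges is present independently with probability $p$. For $d\ge3$ and $dn$ even, $\mathbb{G}(n,d,p)$ is the random graph on $[n]$ obtained by first choosing a simple $d$-regular graph on $[n]$ uniformly at random and then retaining each of its edges independently with probability $p$ (deleting it otherwise). For a graph $\mathbb{G}$, $|\mathcal{C}_{\max}(\mathbb{G})|$ denotes the maximum number of vertices in a connected component of $\mathbb{G}$. *)

theory Defs
  imports "HOL-Analysis.Analysis" "HOL-Library.Landau_Symbols"
begin

text \<open>Simple graphs on the vertex set [n] = {1..n}, represented by their edge sets
  (sets of 2-element subsets of {1..n}).\<close>

definition all_edges :: "nat \<Rightarrow> nat set set" where
  "all_edges n = {e. \<exists>u v. e = {u, v} \<and> u \<noteq> v \<and> u \<in> {1..n} \<and> v \<in> {1..n}}"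

definition adj_rel :: "nat set set \<Rightarrow> (nat \<times> nat) set" where
  "adj_rel E = {(x, y). {x, y} \<in> E \<and> x \<noteq> y}"

definition component :: "nat \<Rightarrow> nat set set \<Rightarrow> nat \<Rightarrow> nat set" where
  "component n E v = {w \<in> {1..n}. (v, w) \<in> (adj_rel E)\<^sup>*}"

definition cmax :: "nat \<Rightarrow> nat set set \<Rightarrow> nat" where
  "cmax n E = Max ((\<lambda>v. card (component n E v)) ` {1..n})"

definition gnp_prob :: "nat \<Rightarrow> real \<Rightarrow> (nat set set \<Rightarrow> bool) \<Rightarrow> real" where
  "gnp_prob n p P =
     (\<Sum>E \<in> Pow (all_edges n).
        if P E then p ^ card E * (1 - p) ^ (card (all_edges n) - card E) else 0)"

definition regular_graphs :: "nat \<Rightarrow> nat \<Rightarrow> nat set set set" where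
  "regular_graphs n d = {D. D \<subseteq> all_edges n \<and> (\<forall>v \<in> {1..n}. card {e \<in> D. v \<in> e} = d)}"

text \<open>Probability that G(n,d,p) satisfies property P: uniform random simple d-regular
  graph D on [n], then each edge of D retained independently with probability p.\<close>
definition gndp_prob :: "nat \<Rightarrow> nat \<Rightarrow> real \<Rightarrow> (nat set set \<Rightarrow> bool) \<Rightarrow> real" where
  "gndp_prob n d p P =
     (1 / real (card (regular_graphs n d))) *
     (\<Sum>D \<in> regular_graphs n d. \<Sum>E \<in> Pow D.
        if P E then p ^ card E * (1 - p) ^ (card D - card E) else 0)"

end

(* Reveal the graph vertex by vertex along its components; small K E Act s says that the part of the
   current component already explored (s vertices) together with what is reachable from the active
   vertices Act stays below K, and so does every other component. Let x be the number of active
   vertices, or of active half-edges in the regular case. As long as only O(n / sqrt K) vertices have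
   been explored, x is nearly a driftless walk of bounded variance, and 3 - (1 + s/K) x^2/(x^2 + bK)
   is a bounded supermartingale that shrinks in mean by a factor 1 - kappa/K at each step: near x = 0
   because of the variance, away from 0 because s grows. Starting a new component only decreases it.
   Hence the probability that no component reaches K is at most 3 (1 - kappa/K)^T with
   T = epsilon n / sqrt K, and K = n^(2/3)/A gives T/K of order A^(3/2).

   In the regular case all neighbours of the explored vertex are revealed, so that the unexplored
   part stays uniform among graphs with the reduced degree sequence. The neighbour number is exact;
   only hits of touched vertices cost drift, and a switching shows that a fixed edge is present with
   probability O(1/n). This works with simple graphs directly, without the configuration model. *)

theory Submission
  imports Defs
begin

section \<open>A Lyapunov function for the exploration walk\<close>

text \<open>Heuristic for the rate: a driftless walk climbs from 0 to height sqrt K in about K steps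
  and from there survives K further steps with probability bounded below. So each block of K steps
  yields a component of size K with positive chance, and T steps contain T / K blocks.
  \<open>lyap\<close> replaces blocks and stopping times by one inequality per step: it uses x^2,
  whose drift comes from the variance, flattened at the scale sqrt K so that it stays bounded. The
  limit n / sqrt K is where depletion begins to matter: after T steps the drift is of order T / n,
  and accumulated over K steps it has to stay below the noise sqrt K. No process or filtration is
  formalised. The probability is expanded one vertex at a time, and the supermartingale bound is the
  claim of an induction on the number of steps still allowed. Sums over graphs stay unnormalised,
  because a reduced degree sequence may admit no graph, and conditional probabilities would then be
  undefined.\<close>

definition lyap :: "real \<Rightarrow> real \<Rightarrow> real \<Rightarrow> real \<Rightarrow> real" where
  "lyap b K x s = 3 - (1 + s / K) * (x\<^sup>2 / (x\<^sup>2 + b * K))"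

text \<open>With D = x^2 + L, Z = (x + \<xi>)^2 + L and t = Z - D the increment is L t / (D Z). As Z
  >= L, replacing 1 / Z by (1 - t / L) / D in t / Z can only lower the value, whatever the size of
  \<xi>. Hence no bound on the jumps is required, only moments up to the fourth.\<close>

lemma ratio_increment_ge:
  fixes x \<xi> L :: real
  assumes "L > 0"
  shows "(x + \<xi>)\<^sup>2 / ((x + \<xi>)\<^sup>2 + L) - x\<^sup>2 / (x\<^sup>2 + L)
    \<ge> L / (x\<^sup>2 + L)\<^sup>2 * (2 * x * \<xi> + \<xi>\<^sup>2 - 8 * x\<^sup>2 / L * \<xi>\<^sup>2 - 2 / L * \<xi> ^ 4)"
proof -
  define D where "D = x\<^sup>2 + L"
  define Z where "Z = (x + \<xi>)\<^sup>2 + L"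
  define t where "t = 2 * x * \<xi> + \<xi>\<^sup>2"
  have D: "D > 0" and Z: "Z \<ge> L" "Z > 0"
    using assms by (auto simp: D_def Z_def add_nonneg_pos)
  have Zt: "Z = D + t"
    by (simp add: Z_def D_def t_def power2_eq_square algebra_simps)
  have lhs: "(x + \<xi>)\<^sup>2 / ((x + \<xi>)\<^sup>2 + L) - x\<^sup>2 / (x\<^sup>2 + L) = L * (t / (D * Z))"
  proof -
    have "(x + \<xi>)\<^sup>2 / ((x + \<xi>)\<^sup>2 + L) - x\<^sup>2 / (x\<^sup>2 + L) = (Z - L) / Z - (D - L) / D"
      by (simp add: Z_def D_def)
    also have "\<dots> = L * ((Z - D) / (D * Z))"
      using D Z by (simp add: field_simps)
    finally show ?thesis using Zt by simp
  qed
  have t2: "t\<^sup>2 \<le> 8 * x\<^sup>2 * \<xi>\<^sup>2 + 2 * \<xi> ^ 4"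
  proof -
    have "8 * x\<^sup>2 * \<xi>\<^sup>2 + 2 * \<xi> ^ 4 - t\<^sup>2 = (2 * x * \<xi> - \<xi>\<^sup>2)\<^sup>2"
      by (simp add: t_def power2_eq_square power4_eq_xxxx algebra_simps)
    then show ?thesis by (smt (verit) zero_le_power2)
  qed
  have "(t - t\<^sup>2 / L) * Z \<le> t * D"
  proof -
    have "t * D - (t - t\<^sup>2 / L) * Z = t\<^sup>2 * ((Z - L) / L)"
      using assms Zt by (simp add: field_simps power2_eq_square)
    moreover have "\<dots> \<ge> 0" using Z assms by simp
    ultimately show ?thesis by linarith
  qed
  then have "(t - t\<^sup>2 / L) / D\<^sup>2 \<le> t / (D * Z)"
    using D Z by (simp add: divide_simps power2_eq_square)
  moreover have "(t - (8 * x\<^sup>2 * \<xi>\<^sup>2 + 2 * \<xi> ^ 4) / L) / D\<^sup>2 \<le> (t - t\<^sup>2 / L) / D\<^sup>2"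
    using t2 assms D by (intro divide_right_mono diff_left_mono) auto
  ultimately have "(t - (8 * x\<^sup>2 * \<xi>\<^sup>2 + 2 * \<xi> ^ 4) / L) / D\<^sup>2 \<le> t / (D * Z)"
    by linarith
  then have "L * ((t - (8 * x\<^sup>2 * \<xi>\<^sup>2 + 2 * \<xi> ^ 4) / L) / D\<^sup>2) \<le> L * (t / (D * Z))"
    using assms by (intro mult_left_mono) auto
  moreover have "L / (x\<^sup>2 + L)\<^sup>2 * (2 * x * \<xi> + \<xi>\<^sup>2 - 8 * x\<^sup>2 / L * \<xi>\<^sup>2 - 2 / L * \<xi> ^ 4)
      = L * ((t - (8 * x\<^sup>2 * \<xi>\<^sup>2 + 2 * \<xi> ^ 4) / L) / D\<^sup>2)"
    by (simp add: t_def D_def add_divide_distrib diff_divide_distrib algebra_simps)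
  ultimately show ?thesis unfolding lhs by simp
qed

lemma lyap_step:
  fixes w \<xi> :: "'i \<Rightarrow> real" and K b x s \<mu> \<nu> \<sigma> V :: real
  assumes I: "finite I" "\<And>i. i \<in> I \<Longrightarrow> 0 \<le> w i"
    and mean: "(\<Sum>i\<in>I. w i * \<xi> i) \<ge> - (\<mu> + \<nu> * x) * sum w I"
    and var: "(\<Sum>i\<in>I. w i * (\<xi> i)\<^sup>2) \<ge> \<sigma> * sum w I"
    and var': "(\<Sum>i\<in>I. w i * (\<xi> i)\<^sup>2) \<le> V * sum w I"
    and fourth: "(\<Sum>i\<in>I. w i * \<xi> i ^ 4) \<le> V * sum w I"
    and x: "x \<ge> 0" and K: "K \<ge> 1" and s: "0 \<le> s" "s \<le> K"
    and \<sigma>: "0 < \<sigma>" "\<sigma> \<le> 1" and b: "b \<ge> 192 * V / \<sigma>" "b \<ge> 192 * V" "b \<ge> 2"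
    and \<mu>: "\<mu>\<^sup>2 * K \<le> \<sigma> / 96" and \<nu>: "\<nu> * K \<le> 1 / 48"
  shows "(\<Sum>i\<in>I. w i * lyap b K (x + \<xi> i) (s + 1))
    \<le> (1 - \<sigma> / (6 * b) / K) * (sum w I * lyap b K x s)"
proof -
  define L where "L = b * K"
  define W where "W = sum w I"
  define g where "g = x\<^sup>2 / (x\<^sup>2 + L)"
  define G where "G = (\<Sum>i\<in>I. w i * ((x + \<xi> i)\<^sup>2 / ((x + \<xi> i)\<^sup>2 + L)))"
  define a where "a = \<sigma> / (2 * b)"
  have L: "L > 0" "L \<ge> b" using b K by (auto simp: L_def)
  have W: "W \<ge> 0" unfolding W_def using I by (intro sum_nonneg)
  have xL: "x\<^sup>2 + L > 0" using L by (simp add: add_nonneg_pos)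
  have g: "0 \<le> g" "g \<le> 1" using L xL by (auto simp: g_def)
  have a: "0 < a" "a \<le> 1 / 4" using \<sigma> b by (auto simp: a_def field_simps)
  have step1: "G - W * g \<ge> L / (x\<^sup>2 + L)\<^sup>2 * (2 * x * (\<Sum>i\<in>I. w i * \<xi> i) + (\<Sum>i\<in>I. w i * (\<xi> i)\<^sup>2)
      - 8 * x\<^sup>2 / L * (\<Sum>i\<in>I. w i * (\<xi> i)\<^sup>2) - 2 / L * (\<Sum>i\<in>I. w i * \<xi> i ^ 4))" (is "_ \<ge> ?R")
  proof -
    have "?R = (\<Sum>i\<in>I. w i * (L / (x\<^sup>2 + L)\<^sup>2 * (2 * x * \<xi> i + (\<xi> i)\<^sup>2 - 8 * x\<^sup>2 / L * (\<xi> i)\<^sup>2 - 2 / L * \<xi> i ^ 4)))"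
    proof -
      have "c * (2 * x * (\<Sum>i\<in>I. w i * \<xi> i) + (\<Sum>i\<in>I. w i * (\<xi> i)\<^sup>2)
          - c8 * (\<Sum>i\<in>I. w i * (\<xi> i)\<^sup>2) - c2 * (\<Sum>i\<in>I. w i * \<xi> i ^ 4))
        = (\<Sum>i\<in>I. w i * (c * (2 * x * \<xi> i + (\<xi> i)\<^sup>2 - c8 * (\<xi> i)\<^sup>2 - c2 * \<xi> i ^ 4)))" for c c8 c2
        by (simp add: sum_distrib_left sum.distrib sum_subtractf algebra_simps)
      then show ?thesis .
    qed
    also have "\<dots> \<le> (\<Sum>i\<in>I. w i * ((x + \<xi> i)\<^sup>2 / ((x + \<xi> i)\<^sup>2 + L) - x\<^sup>2 / (x\<^sup>2 + L)))"
      using I ratio_increment_ge[OF L(1)] by (intro sum_mono mult_left_mono) auto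
    also have "\<dots> = G - W * g"
      unfolding G_def W_def g_def sum_distrib_right by (simp only: sum_subtractf right_diff_distrib)
    finally show ?thesis .
  qed
  have step2: "2 * x * (\<Sum>i\<in>I. w i * \<xi> i) + (\<Sum>i\<in>I. w i * (\<xi> i)\<^sup>2)
      - 8 * x\<^sup>2 / L * (\<Sum>i\<in>I. w i * (\<xi> i)\<^sup>2) - 2 / L * (\<Sum>i\<in>I. w i * \<xi> i ^ 4)
      \<ge> W * (\<sigma> / 2 - x\<^sup>2 * (1 / (8 * K)))"
  proof -
    have m: "2 * x * (\<Sum>i\<in>I. w i * \<xi> i) \<ge> 2 * x * (- (\<mu> + \<nu> * x) * W)"
      using mean x unfolding W_def by (intro mult_left_mono) auto
    have v: "8 * x\<^sup>2 / L * (\<Sum>i\<in>I. w i * (\<xi> i)\<^sup>2) \<le> 8 * x\<^sup>2 / L * (V * W)"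
      using var' L unfolding W_def by (intro mult_left_mono) auto
    have f: "2 / L * (\<Sum>i\<in>I. w i * \<xi> i ^ 4) \<le> 2 / L * (V * W)"
      using fourth L unfolding W_def by (intro mult_left_mono) auto
    \<comment> \<open>Half of \<sigma> is spent: one quarter here on the fourth moment, another in
      \<open>c5\<close> on the constant drift, where completing a square trades 2 x \<mu> for
      \<sigma> / 4 and an x^2 term.\<close>
    have c1: "2 / L * V \<le> \<sigma> / 4"
    proof -
      have "8 * V \<le> \<sigma> * b" if "V \<ge> 0" using b(1) \<sigma> that by (simp add: field_simps)
      moreover have "8 * V \<le> \<sigma> * b" if "V < 0"
        using \<sigma> b that by (smt (verit) mult_pos_pos)
      moreover have "\<sigma> * b \<le> \<sigma> * L" using \<sigma> L by simp
      ultimately have "8 * V \<le> \<sigma> * L" by linarith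
      then show ?thesis using L by (simp add: field_simps)
    qed
    have c2: "8 * V / L \<le> 1 / (24 * K)"
      using b(2) b(3) K by (simp add: L_def field_simps)
    have c3: "2 * \<nu> \<le> 1 / (24 * K)"
      using \<nu> K by (simp add: field_simps)
    have c4: "4 * \<mu>\<^sup>2 / \<sigma> \<le> 1 / (24 * K)"
      using \<mu> K \<sigma> by (simp add: field_simps)
    have c5: "2 * x * \<mu> \<le> \<sigma> / 4 + x\<^sup>2 * (4 * \<mu>\<^sup>2 / \<sigma>)"
    proof -
      have "0 \<le> (\<sigma> - 4 * x * \<mu>)\<^sup>2 / (4 * \<sigma>)" using \<sigma> by simp
      also have "\<dots> = \<sigma> / 4 - 2 * x * \<mu> + x\<^sup>2 * (4 * \<mu>\<^sup>2 / \<sigma>)"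
        using \<sigma> by (simp add: field_simps power2_eq_square)
      finally show ?thesis by simp
    qed
    have "x\<^sup>2 * (8 * V / L) \<le> x\<^sup>2 * (1 / (24 * K))" "x\<^sup>2 * (2 * \<nu>) \<le> x\<^sup>2 * (1 / (24 * K))"
      "x\<^sup>2 * (4 * \<mu>\<^sup>2 / \<sigma>) \<le> x\<^sup>2 * (1 / (24 * K))"
      using c2 c3 c4 by (intro mult_left_mono; simp)+
    moreover have "x\<^sup>2 * (1 / (8 * K)) = 3 * (x\<^sup>2 * (1 / (24 * K)))" by simp
    ultimately have "\<sigma> / 2 - x\<^sup>2 * (1 / (8 * K))
        \<le> - 2 * x * \<mu> - x\<^sup>2 * (2 * \<nu>) + \<sigma> - x\<^sup>2 * (8 * V / L) - 2 / L * V"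
      using c1 c5 by linarith
    then have "W * (\<sigma> / 2 - x\<^sup>2 * (1 / (8 * K)))
        \<le> W * (- 2 * x * \<mu> - x\<^sup>2 * (2 * \<nu>) + \<sigma> - x\<^sup>2 * (8 * V / L) - 2 / L * V)"
      using W by (rule mult_left_mono)
    also have "\<dots> = 2 * x * (- (\<mu> + \<nu> * x) * W) + \<sigma> * W - 8 * x\<^sup>2 / L * (V * W) - 2 / L * (V * W)"
      by (simp add: algebra_simps power2_eq_square)
    finally show ?thesis using m v f var unfolding W_def by linarith
  qed
  \<comment> \<open>Since 1 - g = L / (x^2 + L), the surviving variance term is exactly a (1 - g)^2
    / K, and the x^2 loss is at most (g / 8) / K.\<close>
  have step3: "G \<ge> W * (g + (a * (1 - g)\<^sup>2 - g / 8) / K)"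
  proof -
    have 1: "L / (x\<^sup>2 + L)\<^sup>2 * \<sigma> / 2 = a * (1 - g)\<^sup>2 / K"
    proof -
      have "1 - g = L / (x\<^sup>2 + L)" using xL by (simp add: g_def field_simps)
      then have "(1 - g)\<^sup>2 = L * (L / (x\<^sup>2 + L)\<^sup>2)" by (simp add: power2_eq_square)
      then show ?thesis using K b by (simp add: a_def L_def mult_ac)
    qed
    have 2: "L / (x\<^sup>2 + L)\<^sup>2 * (x\<^sup>2 * (1 / (8 * K))) \<le> g / 8 / K"
    proof -
      have "L / (x\<^sup>2 + L)\<^sup>2 * x\<^sup>2 = g * (L / (x\<^sup>2 + L))"
        by (simp add: g_def power2_eq_square)
      also have "\<dots> \<le> g * 1" using g xL L by (intro mult_left_mono) auto
      finally have "L / (x\<^sup>2 + L)\<^sup>2 * x\<^sup>2 \<le> g" by simp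
      from divide_right_mono[OF this, of "8 * K"] K show ?thesis by simp
    qed
    have "W * (g + (a * (1 - g)\<^sup>2 - g / 8) / K) - W * g
        \<le> W * (L / (x\<^sup>2 + L)\<^sup>2 * \<sigma> / 2 - L / (x\<^sup>2 + L)\<^sup>2 * (x\<^sup>2 * (1 / (8 * K))))"
    proof -
      have "(a * (1 - g)\<^sup>2 - g / 8) / K \<le> L / (x\<^sup>2 + L)\<^sup>2 * \<sigma> / 2 - L / (x\<^sup>2 + L)\<^sup>2 * (x\<^sup>2 * (1 / (8 * K)))"
        using 1 2 by (simp add: diff_divide_distrib)
      from mult_left_mono[OF this W] show ?thesis by (simp add: algebra_simps)
    qed
    also have "\<dots> = L / (x\<^sup>2 + L)\<^sup>2 * (W * (\<sigma> / 2 - x\<^sup>2 * (1 / (8 * K))))"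
      by (simp add: algebra_simps)
    also have "\<dots> \<le> G - W * g"
      using mult_left_mono[OF step2, of "L / (x\<^sup>2 + L)\<^sup>2"] step1 L by (smt (verit) divide_nonneg_nonneg zero_le_power2)
    finally show ?thesis by linarith
  qed
  \<comment> \<open>Increasing s by one adds g / K. The factor 1 + y + k <= 3 enlarges the loss g /
    8 to at most 3 g / 8, so at least g / 2 remains, and this lifts a (1 - g)^2 to a because a <= 1
    / 4.\<close>
  have step4: "(1 + (s + 1) / K) * (g + (a * (1 - g)\<^sup>2 - g / 8) / K) \<ge> (1 + s / K) * g + a / K"
  proof -
    define y where "y = s / K"
    define k where "k = 1 / K"
    define A where "A = a * (1 - g)\<^sup>2"
    have y: "0 \<le> y" "y \<le> 1" using s K by (auto simp: y_def)
    have k: "0 < k" "k \<le> 1" using K by (auto simp: k_def)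
    have A: "A \<ge> 0" using a by (simp add: A_def)
    have Aa: "A + g / 2 \<ge> a"
    proof -
      have "A = a - 2 * a * g + a * g\<^sup>2" by (simp add: A_def power2_eq_square algebra_simps)
      moreover have "2 * a * g \<le> 2 * (1 / 4) * g" using a g by (intro mult_right_mono) auto
      moreover have "a * g\<^sup>2 \<ge> 0" using a by simp
      ultimately show ?thesis by linarith
    qed
    have "(1 + y + k) * (A - g / 8) \<ge> A - 3 * g / 8"
    proof -
      have "(1 + y + k) * A \<ge> 1 * A" using y k A by (intro mult_right_mono) auto
      moreover have "(1 + y + k) * (g / 8) \<le> 3 * (g / 8)" using y k g by (intro mult_right_mono) auto
      ultimately show ?thesis by (simp add: algebra_simps)
    qed
    then have "(1 + y + k) * (A - g / 8) + g \<ge> a" using Aa g by linarith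
    then have "((1 + y + k) * (A - g / 8) + g) * k \<ge> a * k" using k by (intro mult_right_mono) auto
    moreover have "(1 + (s + 1) / K) * (g + (a * (1 - g)\<^sup>2 - g / 8) / K)
       = (1 + y) * g + ((1 + y + k) * (A - g / 8) + g) * k"
      by (simp add: y_def k_def A_def add_divide_distrib diff_divide_distrib algebra_simps)
    ultimately show ?thesis by (simp add: y_def k_def)
  qed
  have "(1 + (s + 1) / K) * G \<ge> W * ((1 + s / K) * g + a / K)"
  proof -
    have "(1 + (s + 1) / K) * G \<ge> (1 + (s + 1) / K) * (W * (g + (a * (1 - g)\<^sup>2 - g / 8) / K))"
      using s K by (intro mult_left_mono[OF step3]) auto
    moreover have "W * ((1 + (s + 1) / K) * (g + (a * (1 - g)\<^sup>2 - g / 8) / K)) \<ge> W * ((1 + s / K) * g + a / K)"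
      using W by (intro mult_left_mono[OF step4])
    ultimately show ?thesis by (simp add: mult_ac)
  qed
  moreover have "(\<Sum>i\<in>I. w i * lyap b K (x + \<xi> i) (s + 1)) = 3 * W - (1 + (s + 1) / K) * G"
    by (simp add: lyap_def G_def W_def L_def sum_subtractf sum_distrib_left sum_distrib_right algebra_simps)
  \<comment> \<open>The additive gain a / K becomes a multiplicative one because the function never
    exceeds 3; this turns a = \<sigma> / (2 b) into the rate \<sigma> / (6 b).\<close>
  moreover have "(1 - \<sigma> / (6 * b) / K) * (W * lyap b K x s) \<ge> W * (3 - (1 + s / K) * g - a / K)"
  proof -
    have "\<sigma> / (6 * b) / K = a / K / 3" by (simp add: a_def)
    moreover have "lyap b K x s = 3 - (1 + s / K) * g" by (simp add: lyap_def g_def L_def)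
    moreover have "(1 - a / K / 3) * (3 - (1 + s / K) * g) \<ge> 3 - (1 + s / K) * g - a / K"
    proof -
      have "(a / K / 3) * ((1 + s / K) * g) \<ge> 0" using a K s g by simp
      moreover have "(1 - a / K / 3) * (3 - (1 + s / K) * g)
         = 3 - (1 + s / K) * g - a / K + (a / K / 3) * ((1 + s / K) * g)"
        by (simp add: algebra_simps)
      ultimately show ?thesis by linarith
    qed
    ultimately show ?thesis using W by (metis mult.left_commute mult_left_mono)
  qed
  ultimately show ?thesis unfolding W_def by (simp add: algebra_simps)
qed

lemma lyap_le_3:
  assumes "0 \<le> s" "0 < b" "0 < K"
  shows "lyap b K x s \<le> 3"
  using assms by (simp add: lyap_def)

text \<open>The factor 1 + s / K is at most 2, and the constant 3 leaves 1: the function has to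
  dominate the trivial bound on a probability once no steps are left.\<close>

lemma lyap_ge_1:
  assumes "0 \<le> s" "s \<le> K" "0 < b" "0 < K"
  shows "1 \<le> lyap b K x s"
proof -
  have "x\<^sup>2 / (x\<^sup>2 + b * K) \<le> 1" using assms by (simp add: divide_simps add_nonneg_pos)
  moreover have "1 + s / K \<le> 2" using assms by simp
  ultimately have "(1 + s / K) * (x\<^sup>2 / (x\<^sup>2 + b * K)) \<le> 2 * 1"
    using assms by (intro mult_mono) auto
  then show ?thesis by (simp add: lyap_def)
qed

lemma lyap_0: "lyap b K 0 s = 3"
  by (simp add: lyap_def)

section \<open>Exploring a percolated graph\<close>

definition pairs :: "nat set \<Rightarrow> nat set set" where
  "pairs V = {e. \<exists>u v. e = {u, v} \<and> u \<noteq> v \<and> u \<in> V \<and> v \<in> V}"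

definition star :: "nat \<Rightarrow> nat set \<Rightarrow> nat set set" where
  "star v N = (\<lambda>w. {v, w}) ` N"

definition nbrs :: "nat \<Rightarrow> nat set set \<Rightarrow> nat set" where
  "nbrs v D = {w. {v, w} \<in> D}"

definition delete_vertex :: "nat \<Rightarrow> nat set set \<Rightarrow> nat set set" where
  "delete_vertex v D = {e \<in> D. v \<notin> e}"

lemma all_edges_eq_pairs: "all_edges n = pairs {1..n}"
  by (simp add: all_edges_def pairs_def)

lemma pairs_subset_Pow: "pairs V \<subseteq> Pow V"
  by (auto simp: pairs_def)

lemma finite_pairs: "finite V \<Longrightarrow> finite (pairs V)"
  by (rule finite_subset[OF pairs_subset_Pow]) simp

lemma insert_mem_pairs_iff [simp]: "{u, v} \<in> pairs V \<longleftrightarrow> u \<noteq> v \<and> u \<in> V \<and> v \<in> V"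
  by (auto simp: pairs_def doubleton_eq_iff)

lemma inj_on_star: "inj_on (\<lambda>w. {v, w}) N"
  by (auto simp: inj_on_def doubleton_eq_iff)

lemma card_star [simp]: "card (star v N) = card N"
  unfolding star_def by (rule card_image[OF inj_on_star])

lemma finite_star [simp]: "finite N \<Longrightarrow> finite (star v N)"
  by (simp add: star_def)

lemma star_Un_delete_vertex:
  assumes "D \<subseteq> pairs V"
  shows "star v (nbrs v D) \<union> delete_vertex v D = D"
proof -
  have "e \<in> star v (nbrs v D) \<union> delete_vertex v D" if "e \<in> D" for e
  proof (cases "v \<in> e")
    case True
    from that assms obtain a b where "e = {a, b}" by (auto simp: pairs_def)
    with True obtain w where "e = {v, w}" by auto
    with that show ?thesis by (auto simp: star_def nbrs_def)
  next
    case False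
    with that show ?thesis by (simp add: delete_vertex_def)
  qed
  then show ?thesis by (auto simp: star_def nbrs_def delete_vertex_def)
qed

lemma nbrs_subset:
  assumes "D \<subseteq> pairs V"
  shows "nbrs v D \<subseteq> V - {v}"
proof
  fix w assume "w \<in> nbrs v D"
  then have "{v, w} \<in> pairs V" using assms unfolding nbrs_def by blast
  then show "w \<in> V - {v}" by simp
qed

lemma delete_vertex_subset:
  assumes "D \<subseteq> pairs V"
  shows "delete_vertex v D \<subseteq> pairs (V - {v})"
proof
  fix e assume "e \<in> delete_vertex v D"
  then have "e \<in> pairs V" "v \<notin> e" using assms by (auto simp: delete_vertex_def)
  then show "e \<in> pairs (V - {v})" by (auto simp: pairs_def)
qed

lemma mem_pairs_subset: "e \<in> pairs V \<Longrightarrow> e \<subseteq> V"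
  by (auto simp: pairs_def)

lemma star_subset_pairs:
  assumes "N \<subseteq> V - {v}"
  shows "star v N \<subseteq> pairs (insert v V)"
  unfolding star_def
proof (rule image_subsetI)
  fix w assume "w \<in> N"
  with assms show "{v, w} \<in> pairs (insert v V)" by auto
qed

lemma pairs_mono: "V \<subseteq> W \<Longrightarrow> pairs V \<subseteq> pairs W"
  unfolding pairs_def by blast

lemma star_Un_subset_pairs:
  assumes "N \<subseteq> V - {v}" "D \<subseteq> pairs (V - {v})"
  shows "star v N \<union> D \<subseteq> pairs (insert v V)"
proof -
  have "pairs (V - {v}) \<subseteq> pairs (insert v V)" by (rule pairs_mono) blast
  then show ?thesis using star_subset_pairs[OF assms(1)] assms(2) by blast
qed

lemma not_mem_if_pairs_Diff: "D \<subseteq> pairs (V - {v}) \<Longrightarrow> e \<in> D \<Longrightarrow> v \<notin> e"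
  using mem_pairs_subset by blast

lemma nbrs_star_Un:
  assumes "D \<subseteq> pairs (V - {v})"
  shows "nbrs v (star v N \<union> D) = N"
  using not_mem_if_pairs_Diff[OF assms] unfolding nbrs_def star_def
  by (auto simp: doubleton_eq_iff)

lemma delete_vertex_star_Un:
  assumes "D \<subseteq> pairs (V - {v})"
  shows "delete_vertex v (star v N \<union> D) = D"
  using not_mem_if_pairs_Diff[OF assms] unfolding delete_vertex_def star_def by blast

lemma star_Int_pairs: "D \<subseteq> pairs (V - {v}) \<Longrightarrow> star v N \<inter> D = {}"
  using not_mem_if_pairs_Diff unfolding star_def by blast

lemma pairs_eq_star_Un:
  assumes "v \<in> V"
  shows "pairs V = star v (V - {v}) \<union> pairs (V - {v})"
proof -
  have "insert v V = V" using assms by blast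
  then have "star v (V - {v}) \<union> pairs (V - {v}) \<subseteq> pairs V"
    using star_Un_subset_pairs[of "V - {v}" V v "pairs (V - {v})"] by simp
  moreover have "pairs V \<subseteq> star v (V - {v}) \<union> pairs (V - {v})"
    using star_Un_delete_vertex[of "pairs V" V v] nbrs_subset[of "pairs V" V v]
      delete_vertex_subset[of "pairs V" V v] unfolding star_def by blast
  ultimately show ?thesis by blast
qed

text \<open>The reachable sets include their starting points, so a number outside the graph reaches
  only itself and the unrestricted quantifier over v merely forces K > 1. The second conjunct is
  what survives a restart, where the first one is given up.\<close>

definition small :: "nat \<Rightarrow> nat set set \<Rightarrow> nat set \<Rightarrow> nat \<Rightarrow> bool" where
  "small K E Act s \<longleftrightarrow> s + card ((adj_rel E)\<^sup>* `` Act) < K \<and> (\<forall>v. card ((adj_rel E)\<^sup>* `` {v}) < K)"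

lemma small_restart: "small K E Act s \<Longrightarrow> small K E {v} 0"
  by (simp add: small_def)

lemma small_less: "small K E Act s \<Longrightarrow> s < K"
  by (simp add: small_def)

lemma finite_adj_rel:
  assumes "finite V" "E \<subseteq> pairs V"
  shows "finite (adj_rel E)"
proof (rule finite_subset)
  show "adj_rel E \<subseteq> V \<times> V"
  proof
    fix z assume z: "z \<in> adj_rel E"
    obtain x y where xy: "z = (x, y)" by (cases z)
    with z assms(2) have "{x, y} \<in> pairs V" unfolding adj_rel_def by blast
    then show "z \<in> V \<times> V" by (simp add: xy)
  qed
qed (use assms in simp)

text \<open>What the new active set reaches in E was already reached from \<open>Act\<close>,
  through v if necessary. The vertex v was counted there but is isolated in E, so it moves from the
  reachable set into the counter. An implication suffices, since only upper bounds on probabilities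
  are sought.\<close>

lemma small_step:
  assumes fin: "finite V" and v: "v \<in> Act" and Act: "Act \<subseteq> V"
    and N: "N \<subseteq> V - {v}" and E: "E \<subseteq> pairs (V - {v})"
    and small: "small K (star v N \<union> E) Act s"
  shows "small K E (Act - {v} \<union> N) (Suc s)"
proof -
  let ?R = "(adj_rel (star v N \<union> E))\<^sup>*" and ?R' = "(adj_rel E)\<^sup>*"
  have vV: "insert v V = V" using v Act by auto
  have finR: "finite (?R `` B)" if "finite B" for B
    using finite_adj_rel[OF fin star_Un_subset_pairs[OF N E, unfolded vV]] that
    by (rule finite_rtrancl_Image)
  have sub: "?R' \<subseteq> ?R"
    by (rule rtrancl_mono) (auto simp: adj_rel_def)
  have iso: "x = v" if "(x, v) \<in> ?R'" for x
    using that
  proof (cases rule: rtranclE)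
    case (step y)
    then have "{y, v} \<in> pairs (V - {v})" using E by (auto simp: adj_rel_def)
    then show ?thesis by simp
  qed
  have "insert v (?R' `` (Act - {v} \<union> N)) \<subseteq> ?R `` Act"
  proof -
    have "(v, w) \<in> ?R" if "w \<in> N" for w
        using that N by (intro r_into_rtrancl) (auto simp: adj_rel_def star_def)
    then have "y \<in> ?R `` Act" if "w \<in> N" "(w, y) \<in> ?R'" for w y
      using that v sub by (meson ImageI rtrancl_trans subsetD)
    then show ?thesis using v sub by auto
  qed
  moreover have "v \<notin> ?R' `` (Act - {v} \<union> N)" using iso N by auto
  moreover have "finite (?R `` Act)" using finR fin Act finite_subset by blast
  ultimately have "Suc (card (?R' `` (Act - {v} \<union> N))) \<le> card (?R `` Act)"
    by (metis card_insert_disjoint card_mono finite_insert finite_subset)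
  moreover have "card (?R' `` {u}) \<le> card (?R `` {u})" for u
    by (rule card_mono[OF finR Image_mono]) (use sub in auto)
  moreover have "s + card (?R `` Act) < K" "card (?R `` {u}) < K" for u
    using small by (simp_all add: small_def)
  ultimately show ?thesis unfolding small_def
    by (metis add_Suc_shift add_le_cancel_left le_less_trans)
qed

lemma small_if_cmax_less:
  assumes "n \<ge> 1" "E \<subseteq> all_edges n" "cmax n E < K"
  shows "small K E {} 0"
proof -
  have E: "E \<subseteq> pairs {1..n}" using assms(2) by (simp add: all_edges_eq_pairs)
  have le: "card (component n E v) < K" if "v \<in> {1..n}" for v
    using assms(3) that unfolding cmax_def by (meson Max_ge finite_atLeastAtMost finite_imageI image_eqI le_less_trans)
  have eq: "(adj_rel E)\<^sup>* `` {v} \<subseteq> component n E v" if v: "v \<in> {1..n}" for v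
  proof -
    have "w \<in> {1..n}" if "(v, w) \<in> (adj_rel E)\<^sup>*" for w
      using that
    proof (cases rule: rtranclE)
      case base
      then show ?thesis using v by simp
    next
      case (step y)
      then have "{y, w} \<in> pairs {1..n}" using E by (auto simp: adj_rel_def)
      then show ?thesis by simp
    qed
    then show ?thesis by (auto simp: component_def)
  qed
  have "finite (component n E v)" for v by (simp add: component_def)
  then have in1: "card ((adj_rel E)\<^sup>* `` {v}) < K" if "v \<in> {1..n}" for v
    using le[OF that] eq[OF that] by (meson card_mono le_less_trans)
  \<comment> \<open>Vertex 1 supplies K > 1, which settles the second conjunct for numbers outside
    the vertex set.\<close>
  have "card {1::nat} \<le> card ((adj_rel E)\<^sup>* `` {1})"
    by (rule card_mono) (auto intro: finite_rtrancl_Image finite_adj_rel[OF _ E])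
  with in1[of 1] assms(1) have K: "1 < K" by auto
  have "card ((adj_rel E)\<^sup>* `` {v}) < K" for v
  proof (cases "v \<in> {1..n}")
    case False
    have "w = v" if "(v, w) \<in> (adj_rel E)\<^sup>*" for w
      using that
    proof (cases rule: converse_rtranclE)
      case (step y)
      then have "{v, y} \<in> pairs {1..n}" using E by (auto simp: adj_rel_def)
      then show ?thesis using False by simp
    qed auto
    then have "(adj_rel E)\<^sup>* `` {v} = {v}" by auto
    then show ?thesis using K by simp
  qed (rule in1)
  then show ?thesis using K by (simp add: small_def)
qed

lemma cmax_ge_1:
  assumes "n \<ge> 1"
  shows "cmax n E \<ge> 1"
proof -
  have "1 \<in> component n E 1" "finite (component n E 1)"
    using assms by (auto simp: component_def)
  then have "1 \<le> card (component n E 1)" by (metis One_nat_def Suc_leI card_gt_0_iff empty_iff)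
  also have "\<dots> \<le> cmax n E"
    unfolding cmax_def using assms by (intro Max_ge) auto
  finally show ?thesis .
qed

section \<open>Percolation on a finite edge set\<close>

definition wt :: "real \<Rightarrow> 'a set \<Rightarrow> 'a set \<Rightarrow> real" where
  "wt p D E = p ^ card E * (1 - p) ^ (card D - card E)"

definition perc :: "real \<Rightarrow> nat set set \<Rightarrow> (nat set set \<Rightarrow> bool) \<Rightarrow> real" where
  "perc p D P = (\<Sum>E\<in>Pow D. if P E then wt p D E else 0)"

lemma wt_nonneg: "0 \<le> p \<Longrightarrow> p \<le> 1 \<Longrightarrow> 0 \<le> wt p D E"
  by (simp add: wt_def)

text \<open>Conditioning on whether the single element x is retained; the moment formulas below
  follow from it by induction.\<close>

lemma sum_wt_insert:
  assumes "finite N" "x \<notin> N"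
  shows "(\<Sum>M\<in>Pow (insert x N). wt p (insert x N) M * F M)
    = p * (\<Sum>M\<in>Pow N. wt p N M * F (insert x M)) + (1 - p) * (\<Sum>M\<in>Pow N. wt p N M * F M)"
proof -
  have *: "card M \<le> card N" "x \<notin> M" "finite M" if "M \<subseteq> N" for M
    using that assms by (auto intro: card_mono finite_subset)
  have "(\<Sum>M\<in>Pow (insert x N). wt p (insert x N) M * F M)
    = (\<Sum>M\<in>Pow N. wt p (insert x N) M * F M) + (\<Sum>M\<in>insert x ` Pow N. wt p (insert x N) M * F M)"
    unfolding Pow_insert using assms by (intro sum.union_disjoint) auto
  also have "(\<Sum>M\<in>insert x ` Pow N. wt p (insert x N) M * F M)
     = (\<Sum>M\<in>Pow N. wt p (insert x N) (insert x M) * F (insert x M))"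
    using assms by (subst sum.reindex) (auto simp: inj_on_def)
  also have "\<dots> = p * (\<Sum>M\<in>Pow N. wt p N M * F (insert x M))"
    unfolding sum_distrib_left using * assms by (intro sum.cong) (auto simp: wt_def)
  also have "(\<Sum>M\<in>Pow N. wt p (insert x N) M * F M) = (1 - p) * (\<Sum>M\<in>Pow N. wt p N M * F M)"
    unfolding sum_distrib_left using * assms by (intro sum.cong) (auto simp: wt_def Suc_diff_le)
  finally show ?thesis by simp
qed

text \<open>The generating function of a binomial variable. The value c = 1 gives total mass 1, and
  c = 2 later controls the fourth moment.\<close>

lemma sum_wt_power:
  assumes "finite N"
  shows "(\<Sum>M\<in>Pow N. wt p N M * c ^ card M) = (1 + p * (c - 1)) ^ card N"
  using assms
proof (induction N)
  case empty
  then show ?case by (simp add: wt_def)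
next
  case (insert x N)
  have "(\<Sum>M\<in>Pow N. wt p N M * c ^ card (insert x M)) = c * (\<Sum>M\<in>Pow N. wt p N M * c ^ card M)"
    unfolding sum_distrib_left using insert by (intro sum.cong) (auto simp: card_insert_if finite_subset)
  then show ?case using insert by (subst sum_wt_insert) (auto simp: algebra_simps)
qed

lemma sum_wt:
  assumes "finite N"
  shows "(\<Sum>M\<in>Pow N. wt p N M) = 1"
  using sum_wt_power[OF assms, of p 1] by simp

lemma sum_wt_linear:
  fixes f :: "'a \<Rightarrow> real"
  assumes "finite N"
  shows "(\<Sum>M\<in>Pow N. wt p N M * sum f M) = p * sum f N"
  using assms
proof (induction N)
  case empty
  then show ?case by simp
next
  case (insert x N)
  have "(\<Sum>M\<in>Pow N. wt p N M * sum f (insert x M)) = (\<Sum>M\<in>Pow N. wt p N M * f x + wt p N M * sum f M)"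
  proof (intro sum.cong refl)
    fix M assume "M \<in> Pow N"
    then have "finite M" "x \<notin> M" using insert by (auto intro: finite_subset)
    then show "wt p N M * sum f (insert x M) = wt p N M * f x + wt p N M * sum f M"
      by (simp add: distrib_left)
  qed
  also have "\<dots> = f x + p * sum f N"
    using insert by (simp add: sum.distrib sum_wt flip: sum_distrib_right)
  finally show ?case using insert by (subst sum_wt_insert) (auto simp: algebra_simps)
qed

lemma perc_mono:
  assumes "0 \<le> p" "p \<le> 1" "\<And>E. E \<subseteq> D \<Longrightarrow> P E \<Longrightarrow> Q E"
  shows "perc p D P \<le> perc p D Q"
  unfolding perc_def using assms by (intro sum_mono) (auto simp: wt_nonneg)

lemma perc_le_1:
  assumes "0 \<le> p" "p \<le> 1" "finite D"
  shows "perc p D P \<le> 1"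
proof -
  have "perc p D P \<le> (\<Sum>E\<in>Pow D. wt p D E)"
    unfolding perc_def using assms by (intro sum_mono) (auto simp: wt_nonneg)
  then show ?thesis using sum_wt assms by metis
qed

text \<open>Edges at v and edges avoiding v are retained independently: E corresponds to the pair of
  the neighbourhood of v in E and E without v, and the weight factorises because the star and D are
  disjoint.\<close>

lemma perc_star_Un:
  assumes fin: "finite V" and N: "N \<subseteq> V - {v}" and D: "D \<subseteq> pairs (V - {v})"
  shows "perc p (star v N \<union> D) P = (\<Sum>M\<in>Pow N. wt p N M * perc p D (\<lambda>E. P (star v M \<union> E)))"
proof -
  have finD: "finite D" "finite N" using D fin finite_pairs N by (meson finite_Diff finite_subset)+
  have card_Un: "card (star v M \<union> E) = card M + card E" if "M \<subseteq> N" "E \<subseteq> D" for M E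
    using that star_Int_pairs[of E V v M] D finD card_star
    by (subst card_Un_disjoint) (auto intro: finite_subset finite_star)
  have "perc p (star v N \<union> D) P
      = (\<Sum>(M, E)\<in>Pow N \<times> Pow D. if P (star v M \<union> E) then wt p (star v N \<union> D) (star v M \<union> E) else 0)"
    unfolding perc_def
  proof (rule sum.reindex_bij_witness[where i = "\<lambda>(M, E). star v M \<union> E"
        and j = "\<lambda>E. (nbrs v E, delete_vertex v E)"])
    fix E assume E: "E \<in> Pow (star v N \<union> D)"
    then have "E \<subseteq> pairs (insert v V)" using star_Un_subset_pairs[OF N D] by blast
    from star_Un_delete_vertex[OF this]
    have eq: "star v (nbrs v E) \<union> delete_vertex v E = E" .
    then show "(case (nbrs v E, delete_vertex v E) of (M, E) \<Rightarrow> star v M \<union> E) = E" by simp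
    have "nbrs v E \<subseteq> nbrs v (star v N \<union> D)" "delete_vertex v E \<subseteq> delete_vertex v (star v N \<union> D)"
      using E by (auto simp: nbrs_def delete_vertex_def)
    then show "(nbrs v E, delete_vertex v E) \<in> Pow N \<times> Pow D"
      using nbrs_star_Un[OF D] delete_vertex_star_Un[OF D] by simp
    show "(case (nbrs v E, delete_vertex v E) of (M, E) \<Rightarrow>
         if P (star v M \<union> E) then wt p (star v N \<union> D) (star v M \<union> E) else 0)
       = (if P E then wt p (star v N \<union> D) E else 0)"
      by (simp add: eq)
  next
    fix ME assume ME: "ME \<in> Pow N \<times> Pow D"
    then obtain M E where [simp]: "ME = (M, E)" and M: "M \<subseteq> N" and E: "E \<subseteq> D" by auto
    have "E \<subseteq> pairs (V - {v})" using E D by blast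
    then show "(nbrs v (case ME of (M, E) \<Rightarrow> star v M \<union> E), delete_vertex v (case ME of (M, E) \<Rightarrow> star v M \<union> E)) = ME"
      by (simp add: nbrs_star_Un delete_vertex_star_Un)
    show "(case ME of (M, E) \<Rightarrow> star v M \<union> E) \<in> Pow (star v N \<union> D)"
      using M E by (auto simp: star_def)
  qed
  also have "\<dots> = (\<Sum>M\<in>Pow N. \<Sum>E\<in>Pow D. if P (star v M \<union> E) then wt p (star v N \<union> D) (star v M \<union> E) else 0)"
    by (simp add: sum.cartesian_product)
  also have "\<dots> = (\<Sum>M\<in>Pow N. wt p N M * perc p D (\<lambda>E. P (star v M \<union> E)))"
    unfolding perc_def sum_distrib_left
  proof (intro sum.cong refl)
    fix M E assume ME: "M \<in> Pow N" "E \<in> Pow D"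
    then have le: "card M \<le> card N" "card E \<le> card D" using finD by (auto intro: card_mono)
    have "wt p (star v N \<union> D) (star v M \<union> E) = wt p N M * wt p D E"
    proof -
      have "card N + card D - (card M + card E) = (card N - card M) + (card D - card E)"
        using le by simp
      then show ?thesis using ME card_Un[of M E] card_Un[of N D] by (simp add: wt_def power_add)
    qed
    then show "(if P (star v M \<union> E) then wt p (star v N \<union> D) (star v M \<union> E) else 0)
      = wt p N M * (if P (star v M \<union> E) then wt p D E else 0)" by simp
  qed
  finally show ?thesis .
qed

lemma gnp_prob_eq_perc: "gnp_prob n p P = perc p (pairs {1..n}) P"
  unfolding gnp_prob_def perc_def wt_def all_edges_eq_pairs ..

section \<open>The binomial random graph\<close>

lemma one_minus_power_le_exp:
  fixes x :: real
  assumes "x \<le> 1"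
  shows "(1 - x) ^ n \<le> exp (- x * real n)"
proof -
  have "1 - x \<le> exp (- x)" using exp_ge_add_one_self[of "- x"] by simp
  then have "(1 - x) ^ n \<le> exp (- x) ^ n" using assms by (intro power_mono) auto
  then show ?thesis by (simp add: exp_of_nat_mult[symmetric] mult.commute)
qed

lemma exp_le_one_minus_power:
  fixes x :: real
  assumes "0 \<le> x" "x \<le> 1 / 2"
  shows "exp (- 2 * x * real n) \<le> (1 - x) ^ n"
proof -
  have "0 \<le> x * (1 - 2 * x)" using assms by simp
  then have "1 \<le> (1 - x) * (1 + 2 * x)" by (simp add: algebra_simps)
  also have "\<dots> \<le> (1 - x) * exp (2 * x)"
    using exp_ge_add_one_self[of "2 * x"] assms by (intro mult_left_mono) auto
  finally have "exp (- 2 * x) \<le> 1 - x" by (simp add: exp_minus field_simps)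
  then have "exp (- 2 * x) ^ n \<le> (1 - x) ^ n" by (intro power_mono) auto
  then show ?thesis by (simp add: exp_of_nat_mult[symmetric] mult.commute)
qed

text \<open>This lets a fourth moment be read off the generating function at 2. The quotient (k -
  1)^4 / 2^k is largest at k = 7, where it is 10.125, hence 11. For k >= 8 the left side grows by a
  factor at most (7/5)^2 < 2 per step.\<close>

lemma fourth_power_le_two_power: "(real k - 1) ^ 4 \<le> 11 * 2 ^ k"
proof (cases "k \<le> 8")
  case True
  then have "k \<in> {0, 1, 2, 3, 4, 5, 6, 7, 8}" by auto
  then show ?thesis by auto
next
  case False
  then have "8 \<le> k" by simp
  then show ?thesis
  proof (induction k rule: dec_induct)
    case base
    then show ?case by simp
  next
    case (step k)
    define y where "y = real k - 1"
    have y: "y \<ge> 7" using step by (simp add: y_def)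
    have "(y + 1)\<^sup>2 \<le> 7 / 5 * y\<^sup>2"
    proof -
      have "7 * y \<le> y * y" using y by (intro mult_right_mono) auto
      then have "0 \<le> 2 * (y * y) - 10 * y - 5" using y by linarith
      then show ?thesis by (simp add: power2_eq_square algebra_simps)
    qed
    then have "((y + 1)\<^sup>2)\<^sup>2 \<le> (7 / 5 * y\<^sup>2)\<^sup>2" by (rule power_mono) simp
    also have "\<dots> = 49 / 25 * y ^ 4" by (simp add: power2_eq_square power4_eq_xxxx)
    also have "\<dots> \<le> 2 * y ^ 4" by (intro mult_right_mono) auto
    finally have "(y + 1) ^ 4 \<le> 2 * y ^ 4" by (simp add: power_mult[symmetric])
    then show ?case using step by (simp add: y_def)
  qed
qed

text \<open>\<open>er_\<sigma>\<close> bounds from below the probability (1 - p)^n >= exp (- 2 p n)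
  that the explored vertex has no neighbour, where p n <= 5 / 4; the walk then moves by -1.
  \<open>er_V\<close> bounds 11 (1 + p)^n <= 11 exp (p n). \<open>er_b\<close> is the smallest value
  that \<open>lyap_step\<close> permits.\<close>

definition er_\<sigma> :: real where "er_\<sigma> = exp (- 3)"
definition er_V :: real where "er_V = 11 * exp 2"
definition er_b :: real where "er_b = 192 * er_V / er_\<sigma>"

lemma er_constants: "0 < er_\<sigma>" "er_\<sigma> \<le> 1" "er_b \<ge> 192 * er_V" "er_b \<ge> 2" "er_\<sigma> / (6 * er_b) \<le> 1"
proof -
  show \<sigma>: "0 < er_\<sigma>" "er_\<sigma> \<le> 1" by (simp_all add: er_\<sigma>_def)
  have V: "er_V \<ge> 11" by (simp add: er_V_def)
  show b: "er_b \<ge> 192 * er_V" using \<sigma> V by (simp add: er_b_def field_simps)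
  then show "er_b \<ge> 2" using V by simp
  then show "er_\<sigma> / (6 * er_b) \<le> 1" using \<sigma> by simp
qed

text \<open>A neighbour that is already active does not enlarge the active set, so the increment has
  mean p (card V - card Act) - 1. As p <= 2 / n, the at most T missing vertices cost 2 T / n, which
  joins \<theta> in the constant drift, and the active ones cost 2 x / n, which is the part
  proportional to x.\<close>

lemma er_step:
  fixes n T K s :: nat and p \<theta> :: real
  assumes V: "finite V" "Act \<subseteq> V" "v \<in> Act" "card V \<le> n" "n \<le> card V + T"
    and n: "n \<ge> 3" and p: "p = (1 + \<theta>) / real n" and \<theta>: "\<bar>\<theta>\<bar> \<le> 1 / 4"
    and K: "K \<ge> 1" "s \<le> K"
    and \<mu>: "(\<bar>\<theta>\<bar> + 2 * real T / real n)\<^sup>2 * real K \<le> er_\<sigma> / 96" and \<nu>: "2 / real n * real K \<le> 1 / 48"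
  shows "(\<Sum>M\<in>Pow (V - {v}). wt p (V - {v}) M * lyap er_b K (card (Act - {v} \<union> M)) (real s + 1))
    \<le> (1 - er_\<sigma> / (6 * er_b) / K) * lyap er_b K (card Act) s"
proof -
  let ?W = "V - {v}"
  let ?\<xi> = "\<lambda>M. real (card (M - Act)) - 1"
  have np: "real n * p = 1 + \<theta>" using n by (simp add: p)
  have p01: "0 \<le> p" "p \<le> 1 / 2"
    using n \<theta> by (auto simp: p field_simps)
  have finW: "finite ?W" "finite Act" using V by (auto intro: finite_subset)
  have one: "sum (wt p ?W) (Pow ?W) = 1" using sum_wt[OF finW(1)] .
  have cardW: "card ?W \<le> n" using V by (meson card_mono Diff_subset le_trans)
  have finM: "finite M" if "M \<in> Pow ?W" for M using that finW finite_subset by blast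
  have not_act: "(\<Sum>w\<in>M. if w \<in> Act then 0 else 1) = real (card (M - Act))" if "finite M" for M
  proof -
    have "(\<Sum>w\<in>M. if w \<in> Act then 0 else 1 :: real) = (\<Sum>w\<in>M - Act. 1)"
      by (rule sum.mono_neutral_cong_right) (use that in auto)
    then show ?thesis by simp
  qed
  have lt: "real (card (Act - {v} \<union> M)) = real (card Act) + ?\<xi> M" if "M \<in> Pow ?W" for M
  proof -
    have "Act - {v} \<union> M = (Act - {v}) \<union> (M - Act)" using that by auto
    moreover have "(Act - {v}) \<inter> (M - Act) = {}" by auto
    ultimately have "card (Act - {v} \<union> M) = card (Act - {v}) + card (M - Act)"
      using finW finM[OF that] by (metis card_Un_disjoint finite_Diff)
    moreover have "card Act = Suc (card (Act - {v}))" using V finW by (metis card_Suc_Diff1)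
    ultimately show ?thesis by simp
  qed
  have bound: "(\<Sum>M\<in>Pow ?W. wt p ?W M * (11 * 2 ^ card M)) \<le> er_V"
  proof -
    have "(\<Sum>M\<in>Pow ?W. wt p ?W M * (11 * 2 ^ card M)) = 11 * (\<Sum>M\<in>Pow ?W. wt p ?W M * 2 ^ card M)"
      by (simp add: sum_distrib_left algebra_simps)
    also have "\<dots> = 11 * (1 + p) ^ card ?W" by (simp add: sum_wt_power[OF finW(1)])
    also have "(1 + p) ^ card ?W \<le> (1 + p) ^ n" using p01 cardW by (intro power_increasing) auto
    also have "\<dots> \<le> exp (p * real n)"
      using one_minus_power_le_exp[of "- p" n] p01 by simp
    also have "\<dots> \<le> exp 2" using np \<theta> by (simp add: mult.commute)
    finally show ?thesis by (simp add: er_V_def)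
  qed
  have \<xi>4: "?\<xi> M ^ 4 \<le> 11 * 2 ^ card M" if "M \<in> Pow ?W" for M
  proof -
    have "(2::real) ^ card (M - Act) \<le> 2 ^ card M"
      using finM[OF that] by (intro power_increasing card_mono) auto
    then show ?thesis using fourth_power_le_two_power[of "card (M - Act)"] by linarith
  qed
  \<comment> \<open>The increment is an integer, so its square is at most its fourth power and the
    second moment inherits the bound.\<close>
  have \<xi>2: "(?\<xi> M)\<^sup>2 \<le> ?\<xi> M ^ 4" for M
  proof (cases "card (M - Act)")
    case (Suc m)
    have "m\<^sup>2 \<le> m ^ 4" by (cases m) (auto intro!: power_increasing)
    then have "real (m\<^sup>2) \<le> real (m ^ 4)" by (simp only: of_nat_le_iff)
    then show ?thesis using Suc by simp
  qed simp
  have "(\<Sum>M\<in>Pow ?W. wt p ?W M * lyap er_b K (real (card Act) + ?\<xi> M) (real s + 1))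
    \<le> (1 - er_\<sigma> / (6 * er_b) / K) * (sum (wt p ?W) (Pow ?W) * lyap er_b K (card Act) s)"
  proof (rule lyap_step[where \<mu> = "\<bar>\<theta>\<bar> + 2 * real T / real n" and \<nu> = "2 / real n" and V = er_V])
    have "(\<Sum>M\<in>Pow ?W. wt p ?W M * ?\<xi> M)
        = (\<Sum>M\<in>Pow ?W. wt p ?W M * (\<Sum>w\<in>M. if w \<in> Act then 0 else 1) - wt p ?W M)"
    proof (intro sum.cong refl)
      fix M assume "M \<in> Pow ?W"
      then have "(\<Sum>w\<in>M. if w \<in> Act then 0 else 1) = real (card (M - Act))"
        by (intro not_act finM)
      then show "wt p ?W M * ?\<xi> M = wt p ?W M * (\<Sum>w\<in>M. if w \<in> Act then 0 else 1) - wt p ?W M"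
        by (simp add: right_diff_distrib)
    qed
    also have "\<dots> = p * (\<Sum>w\<in>?W. if w \<in> Act then 0 else 1) - 1"
      using finW by (simp add: sum_subtractf sum_wt_linear sum_wt)
    also have "(\<Sum>w\<in>?W. if w \<in> Act then 0 else 1) = real (card (?W - Act))"
      using finW by (intro not_act)
    also have "card (?W - Act) = card V - card Act"
    proof -
      have "?W - Act = V - Act" using V by auto
      then show ?thesis using V finW by (simp add: card_Diff_subset)
    qed
    also have "real (card V - card Act) = real (card V) - real (card Act)"
      using V by (simp add: card_mono of_nat_diff)
    also have "p * (real (card V) - real (card Act)) - 1 \<ge> - (\<bar>\<theta>\<bar> + 2 * real T / real n + 2 / real n * real (card Act))"
    proof -
      have "p * (real (card V) - real (card Act)) \<ge> p * (real n - real T - real (card Act))"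
        using V p01 by (intro mult_left_mono) auto
      moreover have "p * (real n - real T - real (card Act)) = 1 + \<theta> - p * (real T + real (card Act))"
        using np by (simp add: algebra_simps)
      moreover have "p * (real T + real (card Act)) \<le> 2 / real n * (real T + real (card Act))"
        using \<theta> n by (intro mult_right_mono) (auto simp: p field_simps)
      moreover have "2 / real n * (real T + real (card Act)) = 2 * real T / real n + 2 / real n * real (card Act)"
        by (simp add: add_divide_distrib algebra_simps)
      ultimately show ?thesis using \<theta> by linarith
    qed
    finally show "- (\<bar>\<theta>\<bar> + 2 * real T / real n + 2 / real n * real (card Act)) * sum (wt p ?W) (Pow ?W)
      \<le> (\<Sum>M\<in>Pow ?W. wt p ?W M * ?\<xi> M)" by (simp add: one)
    have "er_\<sigma> \<le> exp (- 2 * p * real n)"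
      using np \<theta> unfolding er_\<sigma>_def by (simp add: algebra_simps)
    also have "\<dots> \<le> (1 - p) ^ n" by (rule exp_le_one_minus_power[OF p01])
    also have "\<dots> \<le> (1 - p) ^ card ?W" using p01 cardW by (intro power_decreasing) auto
    also have "\<dots> = wt p ?W {} * (?\<xi> {})\<^sup>2" by (simp add: wt_def)
    also have "\<dots> \<le> (\<Sum>M\<in>Pow ?W. wt p ?W M * (?\<xi> M)\<^sup>2)"
      using finW p01 wt_nonneg[of p ?W] by (intro member_le_sum) auto
    finally show "er_\<sigma> * sum (wt p ?W) (Pow ?W) \<le> (\<Sum>M\<in>Pow ?W. wt p ?W M * (?\<xi> M)\<^sup>2)"
      by (simp add: one)
    have m4: "(\<Sum>M\<in>Pow ?W. wt p ?W M * ?\<xi> M ^ 4) \<le> (\<Sum>M\<in>Pow ?W. wt p ?W M * (11 * 2 ^ card M))"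
      using \<xi>4 p01 wt_nonneg[of p ?W] by (intro sum_mono mult_left_mono) auto
    with bound show "(\<Sum>M\<in>Pow ?W. wt p ?W M * ?\<xi> M ^ 4) \<le> er_V * sum (wt p ?W) (Pow ?W)"
      by (simp add: one)
    have "(\<Sum>M\<in>Pow ?W. wt p ?W M * (?\<xi> M)\<^sup>2) \<le> (\<Sum>M\<in>Pow ?W. wt p ?W M * ?\<xi> M ^ 4)"
      using \<xi>2 p01 wt_nonneg[of p ?W] by (intro sum_mono mult_left_mono) auto
    with m4 bound show "(\<Sum>M\<in>Pow ?W. wt p ?W M * (?\<xi> M)\<^sup>2) \<le> er_V * sum (wt p ?W) (Pow ?W)"
      by (simp add: one)
  qed (use finW p01 K \<mu> \<nu> er_constants in \<open>auto simp: wt_nonneg er_b_def\<close>)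
  also have "(\<Sum>M\<in>Pow ?W. wt p ?W M * lyap er_b K (real (card Act) + ?\<xi> M) (real s + 1))
    = (\<Sum>M\<in>Pow ?W. wt p ?W M * lyap er_b K (card (Act - {v} \<union> M)) (real s + 1))"
    by (intro sum.cong refl) (simp only: lt)
  finally show ?thesis by (simp add: one)
qed

lemma er_small_prob_le:
  fixes n T K :: nat and p \<theta> :: real
  assumes n: "n \<ge> 3" and p: "p = (1 + \<theta>) / real n" and \<theta>: "\<bar>\<theta>\<bar> \<le> 1 / 4"
    and K: "K \<ge> 1" and T: "T \<le> n"
    and \<mu>: "(\<bar>\<theta>\<bar> + 2 * real T / real n)\<^sup>2 * real K \<le> er_\<sigma> / 96" and \<nu>: "2 / real n * real K \<le> 1 / 48"
  shows "gnp_prob n p (\<lambda>E. cmax n E < K) \<le> 3 * exp (- (er_\<sigma> / (6 * er_b)) * real T / real K)"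
proof -
  define \<rho> where "\<rho> = 1 - er_\<sigma> / (6 * er_b) / K"
  have p01: "0 \<le> p" "p \<le> 1"
    using n \<theta> by (auto simp: p field_simps)
  have \<kappa>: "er_\<sigma> / (6 * er_b) / K \<le> 1"
  proof -
    have "er_\<sigma> / (6 * er_b) / K \<le> 1 / K" by (rule divide_right_mono[OF er_constants(5)]) simp
    also have "\<dots> \<le> 1" using K by simp
    finally show ?thesis .
  qed
  then have \<rho>: "\<rho> \<ge> 0" by (simp add: \<rho>_def)
  have bK: "er_b > 0" "real K > 0" using er_constants K by auto
  \<comment> \<open>Here t is the number of steps still allowed and T - t vertices have been
    removed. At t = 0 the bound is at least 1 and there is nothing to prove.\<close>
  have main: "perc p (pairs V) (\<lambda>E. small K E Act s) \<le> \<rho> ^ t * lyap er_b K (card Act) s"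
    if "finite V" "card V + T = n + t" "t \<le> T" "Act \<subseteq> V" "s \<le> K" for t V Act s
    using that
  proof (induction t arbitrary: V Act s)
    case 0
    have "perc p (pairs V) (\<lambda>E. small K E Act s) \<le> 1"
      using p01 0 finite_pairs by (intro perc_le_1) auto
    also have "1 \<le> lyap er_b K (card Act) s"
      using 0 bK by (intro lyap_ge_1) auto
    finally show ?case by simp
  next
    case (Suc t)
    have act: "perc p (pairs V) (\<lambda>E. small K E Act s) \<le> \<rho> ^ Suc t * lyap er_b K (card Act) s"
      if "v \<in> Act" "Act \<subseteq> V" "s \<le> K" for v Act s
    \<comment> \<open>For s = K the event is impossible. For s < K the successor is still at most K,
      which keeps the function at least 1 at every later state.\<close>
    proof (cases "s < K")
      case False
      then have "perc p (pairs V) (\<lambda>E. small K E Act s) = 0"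
        using small_less by (auto simp: perc_def intro!: sum.neutral)
      also have "0 \<le> \<rho> ^ Suc t * lyap er_b K (card Act) s"
        using \<rho> lyap_ge_1[of s K er_b "card Act"] bK that by (intro mult_nonneg_nonneg) auto
      finally show ?thesis .
    next
      case True
      let ?W = "V - {v}"
      have v: "v \<in> V" using that by auto
      have "perc p (pairs V) (\<lambda>E. small K E Act s)
        = (\<Sum>M\<in>Pow ?W. wt p ?W M * perc p (pairs ?W) (\<lambda>E. small K (star v M \<union> E) Act s))"
        unfolding pairs_eq_star_Un[OF v]
        by (rule perc_star_Un[OF Suc.prems(1) order_refl order_refl])
      also have "\<dots> \<le> (\<Sum>M\<in>Pow ?W. wt p ?W M * (\<rho> ^ t * lyap er_b K (card (Act - {v} \<union> M)) (Suc s)))"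
      proof (intro sum_mono mult_left_mono wt_nonneg p01)
        fix M assume M: "M \<in> Pow ?W"
        have "perc p (pairs ?W) (\<lambda>E. small K (star v M \<union> E) Act s)
          \<le> perc p (pairs ?W) (\<lambda>E. small K E (Act - {v} \<union> M) (Suc s))"
          using small_step[OF Suc.prems(1) that(1,2)] M by (intro perc_mono p01) auto
        also have "\<dots> \<le> \<rho> ^ t * lyap er_b K (card (Act - {v} \<union> M)) (Suc s)"
        proof (rule Suc.IH)
          have "card V = Suc (card ?W)" using v Suc.prems(1) by (metis card_Suc_Diff1)
          then show "card ?W + T = n + t" using Suc.prems by simp
        qed (use Suc.prems True M that in auto)
        finally show "perc p (pairs ?W) (\<lambda>E. small K (star v M \<union> E) Act s)
          \<le> \<rho> ^ t * lyap er_b K (card (Act - {v} \<union> M)) (Suc s)" .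
      qed
      also have "\<dots> = \<rho> ^ t * (\<Sum>M\<in>Pow ?W. wt p ?W M * lyap er_b K (card (Act - {v} \<union> M)) (real s + 1))"
        by (simp add: sum_distrib_left mult_ac add.commute)
      also have "\<dots> \<le> \<rho> ^ t * (\<rho> * lyap er_b K (card Act) s)"
      proof (rule mult_left_mono)
        show "(\<Sum>M\<in>Pow ?W. wt p ?W M * lyap er_b K (card (Act - {v} \<union> M)) (real s + 1))
          \<le> \<rho> * lyap er_b K (card Act) s"
          unfolding \<rho>_def
          by (rule er_step[where n = n and T = T and \<theta> = \<theta>]) (use Suc.prems that n p \<theta> K \<mu> \<nu> in auto)
      qed (use \<rho> in simp)
      finally show ?thesis by (simp add: mult_ac)
    qed
    show ?case
    proof (cases "Act = {}")
      case False
      then show ?thesis using act Suc.prems by blast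
    next
      case True
      have "card V > 0" using Suc.prems T by linarith
      then obtain v where v: "v \<in> V" by (metis card_gt_0_iff ex_in_conv)
      have "perc p (pairs V) (\<lambda>E. small K E Act s) \<le> perc p (pairs V) (\<lambda>E. small K E {v} 0)"
        using p01 small_restart by (intro perc_mono) auto
      also have "\<dots> \<le> \<rho> ^ Suc t * lyap er_b K (card {v}) (real 0)"
        using act[of v "{v}" 0] v by simp
      also have "\<dots> \<le> \<rho> ^ Suc t * lyap er_b K (card Act) s"
        using \<rho> lyap_le_3[of 0 er_b K 1] bK True by (intro mult_left_mono) (auto simp: lyap_0)
      finally show ?thesis .
    qed
  qed
  have "gnp_prob n p (\<lambda>E. cmax n E < K) = perc p (pairs {1..n}) (\<lambda>E. cmax n E < K)"
    by (rule gnp_prob_eq_perc)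
  also have "\<dots> \<le> perc p (pairs {1..n}) (\<lambda>E. small K E {} 0)"
    using p01 n small_if_cmax_less[of n] by (intro perc_mono) (auto simp: all_edges_eq_pairs)
  also have "\<dots> \<le> \<rho> ^ T * 3"
    using main[of "{1..n}" T "{}" 0] by (simp add: lyap_0)
  also have "\<rho> ^ T \<le> exp (- (er_\<sigma> / (6 * er_b) / K) * real T)"
    unfolding \<rho>_def by (rule one_minus_power_le_exp[OF \<kappa>])
  finally show ?thesis by simp
qed

section \<open>Graphs with a given degree sequence\<close>

definition rgraphs :: "nat set \<Rightarrow> (nat \<Rightarrow> nat) \<Rightarrow> nat set set set" where
  "rgraphs V r = {D. D \<subseteq> pairs V \<and> (\<forall>w\<in>V. card (nbrs w D) = r w)}"

definition rdec :: "(nat \<Rightarrow> nat) \<Rightarrow> nat set \<Rightarrow> nat \<Rightarrow> nat" where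
  "rdec r N w = (if w \<in> N then r w - 1 else r w)"

(* The condition r w > 0 excludes the neighbourhoods for which rdec would truncate. *)
definition nsets :: "nat set \<Rightarrow> (nat \<Rightarrow> nat) \<Rightarrow> nat \<Rightarrow> nat set set" where
  "nsets V r v = {N. N \<subseteq> V - {v} \<and> card N = r v \<and> (\<forall>w\<in>N. r w > 0)}"

lemma regular_graphs_eq: "regular_graphs n d = rgraphs {1..n} (\<lambda>_. d)"
proof -
  have *: "card {e \<in> D. v \<in> e} = card (nbrs v D)" if "D \<subseteq> pairs {1..n}" for D v
  proof -
    have "{e \<in> D. v \<in> e} = star v (nbrs v D)"
      using star_Un_delete_vertex[OF that, of v] unfolding star_def delete_vertex_def by blast
    then show ?thesis by simp
  qed
  show ?thesis unfolding regular_graphs_def rgraphs_def all_edges_eq_pairs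
    by (intro Collect_cong conj_cong refl ball_cong) (simp add: *)
qed

lemma finite_rgraphs: "finite V \<Longrightarrow> finite (rgraphs V r)"
  by (rule finite_subset[of _ "Pow (pairs V)"]) (auto simp: rgraphs_def finite_pairs)

lemma finite_nsets: "finite V \<Longrightarrow> finite (nsets V r v)"
  by (rule finite_subset[of _ "Pow V"]) (auto simp: nsets_def)

lemma nbrs_star_Un_other:
  assumes "w \<noteq> v"
  shows "nbrs w (star v N \<union> D) = (if w \<in> N then insert v (nbrs w D) else nbrs w D)"
  using assms by (auto simp: nbrs_def star_def doubleton_eq_iff)

lemma card_nbrs_star_Un_other:
  assumes "finite V" "w \<noteq> v" "D \<subseteq> pairs (V - {v})"
  shows "card (nbrs w (star v N \<union> D)) = card (nbrs w D) + (if w \<in> N then 1 else 0)"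
proof -
  have "nbrs w D \<subseteq> V - {v} - {w}" using nbrs_subset[OF assms(3)] .
  then have "finite (nbrs w D)" "v \<notin> nbrs w D" using assms(1) by (auto intro: finite_subset)
  then show ?thesis using assms(2) by (simp add: nbrs_star_Un_other)
qed

text \<open>For a fixed neighbourhood N, deleting v is a bijection onto all graphs on the remaining
  vertices whose degrees are lowered by one on N. This is the Markov property of the exploration; F
  = 1 gives the count, other F give expectations.\<close>

lemma sum_rgraphs:
  fixes F :: "nat set set \<Rightarrow> real"
  assumes "finite V" "v \<in> V"
  shows "(\<Sum>D\<in>rgraphs V r. F D)
    = (\<Sum>N\<in>nsets V r v. \<Sum>D\<in>rgraphs (V - {v}) (rdec r N). F (star v N \<union> D))"
proof -
  have ins: "insert v V = V" using assms(2) by auto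
  have "(\<Sum>D\<in>rgraphs V r. F D)
    = (\<Sum>(N, D)\<in>Sigma (nsets V r v) (\<lambda>N. rgraphs (V - {v}) (rdec r N)). F (star v N \<union> D))"
  proof (rule sum.reindex_bij_witness[where i = "\<lambda>(N, D). star v N \<union> D"
        and j = "\<lambda>D. (nbrs v D, delete_vertex v D)"])
    fix D assume "D \<in> rgraphs V r"
    then have D: "D \<subseteq> pairs V" and deg: "\<And>w. w \<in> V \<Longrightarrow> card (nbrs w D) = r w"
      by (auto simp: rgraphs_def)
    have eq: "star v (nbrs v D) \<union> delete_vertex v D = D" by (rule star_Un_delete_vertex[OF D])
    then show "(case (nbrs v D, delete_vertex v D) of (N, D) \<Rightarrow> star v N \<union> D) = D"
      "(case (nbrs v D, delete_vertex v D) of (N, D) \<Rightarrow> F (star v N \<union> D)) = F D"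
      by simp_all
    have del: "delete_vertex v D \<subseteq> pairs (V - {v})" by (rule delete_vertex_subset[OF D])
    have deg': "r w = card (nbrs w (delete_vertex v D)) + (if w \<in> nbrs v D then 1 else 0)"
      if "w \<in> V - {v}" for w
      using card_nbrs_star_Un_other[OF assms(1) _ del, of w "nbrs v D"] that deg[of w] eq by auto
    have nb: "nbrs v D \<subseteq> V - {v}" by (rule nbrs_subset[OF D])
    have "r w > 0" if "w \<in> nbrs v D" for w
    proof -
      have "w \<in> V - {v}" using that nb by blast
      from deg'[OF this] that show ?thesis by simp
    qed
    then have "nbrs v D \<in> nsets V r v"
      using nb deg[OF assms(2)] by (simp add: nsets_def)
    moreover have "delete_vertex v D \<in> rgraphs (V - {v}) (rdec r (nbrs v D))"
      using del deg' by (auto simp: rgraphs_def rdec_def)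
    ultimately show "(nbrs v D, delete_vertex v D) \<in> Sigma (nsets V r v) (\<lambda>N. rgraphs (V - {v}) (rdec r N))"
      by simp
  next
    fix ND assume "ND \<in> Sigma (nsets V r v) (\<lambda>N. rgraphs (V - {v}) (rdec r N))"
    then obtain N D where [simp]: "ND = (N, D)" and N: "N \<in> nsets V r v"
      and "D \<in> rgraphs (V - {v}) (rdec r N)" by auto
    then have D: "D \<subseteq> pairs (V - {v})" and deg: "\<And>w. w \<in> V - {v} \<Longrightarrow> card (nbrs w D) = rdec r N w"
      by (auto simp: rgraphs_def)
    show "(nbrs v (case ND of (N, D) \<Rightarrow> star v N \<union> D), delete_vertex v (case ND of (N, D) \<Rightarrow> star v N \<union> D)) = ND"
      by (simp add: nbrs_star_Un[OF D] delete_vertex_star_Un[OF D])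
    have "card (nbrs w (star v N \<union> D)) = r w" if "w \<in> V" for w
    proof (cases "w = v")
      case True
      then show ?thesis using N by (simp add: nbrs_star_Un[OF D] nsets_def)
    next
      case False
      then show ?thesis using that deg[of w] N
        by (auto simp: card_nbrs_star_Un_other[OF assms(1) False D] rdec_def nsets_def)
    qed
    moreover have "star v N \<union> D \<subseteq> pairs V"
      using star_Un_subset_pairs[of N V v D] N D ins by (simp add: nsets_def)
    ultimately show "(case ND of (N, D) \<Rightarrow> star v N \<union> D) \<in> rgraphs V r"
      by (simp add: rgraphs_def)
  qed
  also have "\<dots> = (\<Sum>N\<in>nsets V r v. \<Sum>D\<in>rgraphs (V - {v}) (rdec r N). F (star v N \<union> D))"
    using assms by (subst sum.Sigma) (auto simp: finite_nsets finite_rgraphs)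
  finally show ?thesis .
qed

section \<open>Switchings and the probability of a fixed edge\<close>

lemma mem_nbrs_commute: "a \<in> nbrs b D \<longleftrightarrow> b \<in> nbrs a D"
  by (simp add: nbrs_def insert_commute)

text \<open>Stated for one endpoint only: renamings of x, y, a, b that preserve the switching carry
  it to the other three.\<close>

lemma nbrs_switch:
  assumes "x \<noteq> y" "x \<noteq> a" "y \<noteq> b" "x \<noteq> b" "y \<noteq> a" "a \<noteq> b"
  shows "nbrs x (D - {{x, y}, {a, b}} \<union> {{x, a}, {y, b}}) = insert a (nbrs x D - {y})"
proof (rule set_eqI)
  fix z
  have "{x, z} = {x, y} \<longleftrightarrow> z = y" "{x, z} = {x, a} \<longleftrightarrow> z = a" "{x, z} \<noteq> {a, b}" "{x, z} \<noteq> {y, b}"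
    using assms unfolding doubleton_eq_iff by blast+
  then show "z \<in> nbrs x (D - {{x, y}, {a, b}} \<union> {{x, a}, {y, b}}) \<longleftrightarrow> z \<in> insert a (nbrs x D - {y})"
    unfolding nbrs_def mem_Collect_eq Un_iff Diff_iff insert_iff empty_iff by blast
qed

lemma nbrs_switch_other:
  assumes "u \<noteq> x" "u \<noteq> y" "u \<noteq> a" "u \<noteq> b"
  shows "nbrs u (D - {{x, y}, {a, b}} \<union> {{x, a}, {y, b}}) = nbrs u D"
proof (rule set_eqI)
  fix z
  have "{u, z} \<noteq> {x, y}" "{u, z} \<noteq> {x, a}" "{u, z} \<noteq> {a, b}" "{u, z} \<noteq> {y, b}"
    using assms unfolding doubleton_eq_iff by blast+
  then show "z \<in> nbrs u (D - {{x, y}, {a, b}} \<union> {{x, a}, {y, b}}) \<longleftrightarrow> z \<in> nbrs u D"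
    unfolding nbrs_def mem_Collect_eq Un_iff Diff_iff insert_iff empty_iff by blast
qed

lemma switch_mem_rgraphs:
  assumes D: "D \<in> rgraphs V r" and fin: "finite V"
    and e: "{x, y} \<in> D" "{a, b} \<in> D" and ne: "{x, a} \<notin> D" "{y, b} \<notin> D" "x \<noteq> a" "y \<noteq> b"
  shows "D - {{x, y}, {a, b}} \<union> {{x, a}, {y, b}} \<in> rgraphs V r"
proof -
  let ?D = "D - {{x, y}, {a, b}} \<union> {{x, a}, {y, b}}"
  have Dp: "D \<subseteq> pairs V" and deg: "\<And>w. w \<in> V \<Longrightarrow> card (nbrs w D) = r w"
    using D by (auto simp: rgraphs_def)
  have "{x, y} \<in> pairs V" "{a, b} \<in> pairs V" using subsetD[OF Dp] e by fast+
  then have V: "x \<in> V" "y \<in> V" "a \<in> V" "b \<in> V" "x \<noteq> y" "a \<noteq> b" by auto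
  \<comment> \<open>If x = b, then {x, a} would be the edge {a, b}; if y = a, then {y, b} would
    be.\<close>
  have d: "x \<noteq> b" "y \<noteq> a" using e ne by (auto simp: insert_commute)
  have finn: "finite (nbrs w D)" for w using nbrs_subset[OF Dp] fin by (meson finite_Diff finite_subset)
  have swap: "card (insert q (nbrs u D - {z})) = card (nbrs u D)" if "z \<in> nbrs u D" "q \<notin> nbrs u D" for u z q
  proof -
    have "card (insert q (nbrs u D - {z})) = Suc (card (nbrs u D - {z}))"
      using finn[of u] that by (intro card_insert_disjoint) auto
    then show ?thesis using card_Suc_Diff1[OF finn that(1)] by simp
  qed
  have "card (nbrs u ?D) = card (nbrs u D)" for u
  proof -
    consider "u = x" | "u = y" | "u = a" | "u = b" | "u \<noteq> x" "u \<noteq> y" "u \<noteq> a" "u \<noteq> b" by blast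
    then show ?thesis
    proof cases
      case 1
      have "nbrs x ?D = insert a (nbrs x D - {y})" using nbrs_switch V d ne by metis
      then show ?thesis using 1 swap[of y x a] e ne by (simp add: nbrs_def)
    next
      case 2
      have "?D = D - {{y, x}, {b, a}} \<union> {{y, b}, {x, a}}" by (simp add: insert_commute)
      then have "nbrs y ?D = insert b (nbrs y D - {x})" using nbrs_switch[of y x b a D] V d ne by metis
      then show ?thesis using 2 swap[of x y b] e ne by (simp add: nbrs_def insert_commute)
    next
      case 3
      have "?D = D - {{a, b}, {x, y}} \<union> {{a, x}, {b, y}}" by (simp add: insert_commute)
      then have "nbrs a ?D = insert x (nbrs a D - {b})" using nbrs_switch[of a b x y D] V d ne by metis
      then show ?thesis using 3 swap[of b a x] e ne by (simp add: nbrs_def insert_commute)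
    next
      case 4
      have "?D = D - {{b, a}, {y, x}} \<union> {{b, y}, {a, x}}" by (simp add: insert_commute)
      then have "nbrs b ?D = insert y (nbrs b D - {a})" using nbrs_switch[of b a y x D] V d ne by metis
      then show ?thesis using 4 swap[of a b y] e ne by (simp add: nbrs_def insert_commute)
    next
      case 5
      from nbrs_switch_other[OF this] show ?thesis by simp
    qed
  qed
  moreover have "?D \<subseteq> pairs V"
  proof -
    have "{x, a} \<in> pairs V" "{y, b} \<in> pairs V" using V ne by simp_all
    then show ?thesis using Dp by blast
  qed
  ultimately show ?thesis using deg by (simp add: rgraphs_def)
qed

text \<open>Double counting of switchings that remove the edge xy. A graph containing xy admits at
  least (degree sum) - 2 d (d + 1) choices of an oriented edge (a, b). The result has a adjacent to
  x and b adjacent to y, so each graph arises with at most d^2 pairs, and the pair determines the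
  inverse switching.\<close>

lemma card_rgraphs_edge_le:
  assumes fin: "finite V" and r: "\<And>u. u \<in> V \<Longrightarrow> r u \<le> d"
  shows "real (card {D \<in> rgraphs V r. {x, y} \<in> D}) * (real (\<Sum>u\<in>V. r u) - 2 * real d * (real d + 1))
    \<le> (real d)\<^sup>2 * real (card (rgraphs V r))"
proof -
  let ?G = "rgraphs V r"
  let ?H = "{D \<in> ?G. {x, y} \<in> D}"
  \<comment> \<open>Edges are oriented, so all of them together number the degree sum. Excluded are
    a in the closed neighbourhood of x and b in that of y, which costs at most d (d + 1)
    orientations each.\<close>
  define Q where "Q D = {(a, b). {a, b} \<in> D \<and> a \<notin> insert x (nbrs x D) \<and> b \<notin> insert y (nbrs y D)}" for D
  have finG: "finite ?G" by (rule finite_rgraphs[OF fin])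
  have nb: "nbrs u D \<subseteq> V" "finite (nbrs u D)" if "D \<in> ?G" for u D
    using nbrs_subset[of D V u] that fin by (auto simp: rgraphs_def intro: finite_subset)
  \<comment> \<open>Vertices outside V have no neighbours, so x and y need not be assumed to lie in
    V.\<close>
  have le_d: "card (nbrs u D) \<le> d" if "D \<in> ?G" for u D
  proof (cases "u \<in> V")
    case True
    then show ?thesis using that r by (simp add: rgraphs_def)
  next
    case False
    then have "w \<notin> nbrs u D" for w using nb(1)[OF that, of w] by (auto simp: mem_nbrs_commute[of w])
    then have "nbrs u D = {}" by blast
    then show ?thesis by simp
  qed
  have fib: "finite (Q D)" "real (card (Q D)) \<ge> real (\<Sum>u\<in>V. r u) - 2 * real d * (real d + 1)" if D: "D \<in> ?G" for D
  proof -
    let ?P = "Sigma V (\<lambda>a. nbrs a D)"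
    let ?B = "\<lambda>x. Sigma (insert x (nbrs x D)) (\<lambda>a. nbrs a D)"
    have sub: "Q D \<subseteq> ?P"
    proof (rule subrelI)
      fix a b assume "(a, b) \<in> Q D"
      then have b: "b \<in> nbrs a D" by (simp add: Q_def nbrs_def)
      then have "a \<in> nbrs b D" by (simp add: mem_nbrs_commute)
      with nb(1)[OF D] b show "(a, b) \<in> ?P" by auto
    qed
    have finP: "finite ?P" using fin nb(2)[OF D] by auto
    then show "finite (Q D)" using sub finite_subset by blast
    have cardB: "card (?B x) \<le> d * (d + 1)" "finite (?B x)" for x
    proof -
      have "card (?B x) = (\<Sum>a\<in>insert x (nbrs x D). card (nbrs a D))"
        using nb(2)[OF D] by (intro card_SigmaI) auto
      also have "\<dots> \<le> card (insert x (nbrs x D)) * d"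
        by (rule order_trans[OF sum_bounded_above[where K = d]]) (use le_d[OF D] in auto)
      also have "card (insert x (nbrs x D)) \<le> d + 1"
        using card_insert_if[OF nb(2)[OF D], of x x] le_d[OF D, of x] by simp
      finally show "card (?B x) \<le> d * (d + 1)" by (simp add: mult.commute)
      show "finite (?B x)" using nb(2)[OF D] by auto
    qed
    have "?P \<subseteq> Q D \<union> (?B x \<union> prod.swap ` ?B y)"
    proof (rule subrelI)
      fix a b assume ab: "(a, b) \<in> ?P"
      show "(a, b) \<in> Q D \<union> (?B x \<union> prod.swap ` ?B y)"
      proof (cases "(a, b) \<in> Q D \<union> ?B x")
        case False
        then have "b \<in> insert y (nbrs y D)" "a \<in> nbrs b D"
          using ab by (auto simp: Q_def nbrs_def insert_commute)
        then have "(b, a) \<in> ?B y" by simp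
        then show ?thesis by (metis UnI2 image_eqI swap_simp)
      qed blast
    qed
    then have "card ?P \<le> card (Q D \<union> (?B x \<union> prod.swap ` ?B y))"
      using \<open>finite (Q D)\<close> cardB(2) by (intro card_mono) auto
    also have "\<dots> \<le> card (Q D) + (card (?B x) + card (prod.swap ` ?B y))"
      by (meson card_Un_le add_left_mono le_trans)
    also have "card (prod.swap ` ?B y) \<le> card (?B y)" using cardB(2) by (rule card_image_le)
    finally have "card ?P \<le> card (Q D) + 2 * (d * (d + 1))"
      using cardB(1)[of x] cardB(1)[of y] by linarith
    moreover have "card ?P = (\<Sum>u\<in>V. r u)"
    proof -
      have "card ?P = (\<Sum>a\<in>V. card (nbrs a D))" using fin nb(2)[OF D] by (intro card_SigmaI) auto
      also have "\<dots> = (\<Sum>u\<in>V. r u)" using D by (intro sum.cong) (auto simp: rgraphs_def)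
      finally show ?thesis .
    qed
    ultimately have "real (\<Sum>u\<in>V. r u) \<le> real (card (Q D) + 2 * (d * (d + 1)))"
      by (simp only: of_nat_le_iff)
    then show "real (card (Q D)) \<ge> real (\<Sum>u\<in>V. r u) - 2 * real d * (real d + 1)"
      by (simp add: algebra_simps)
  qed
  let ?S = "Sigma ?H Q" and ?T = "Sigma ?G (\<lambda>D. nbrs x D \<times> nbrs y D)"
  let ?f = "\<lambda>(D, a, b). (D - {{x, y}, {a, b}} \<union> {{x, a}, {y, b}}, a, b)"
  have "real (card ?H) * (real (\<Sum>u\<in>V. r u) - 2 * real d * (real d + 1)) \<le> (\<Sum>D\<in>?H. real (card (Q D)))"
    using fib(2) by (intro sum_bounded_below) auto
  also have "\<dots> = real (card ?S)"
    using finG fib(1) by (subst card_SigmaI) auto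
  also have "card ?S \<le> card ?T"
  proof (rule card_inj_on_le)
    show "finite ?T" using finG nb(2) by auto
    show "?f ` ?S \<subseteq> ?T"
    proof
      fix z assume "z \<in> ?f ` ?S"
      then obtain D a b where z: "z = (D - {{x, y}, {a, b}} \<union> {{x, a}, {y, b}}, a, b)"
        and D: "D \<in> ?G" and e: "{x, y} \<in> D" and Q: "(a, b) \<in> Q D" by auto
      have "D - {{x, y}, {a, b}} \<union> {{x, a}, {y, b}} \<in> ?G"
        using Q by (intro switch_mem_rgraphs D fin e) (auto simp: Q_def nbrs_def)
      then show "z \<in> ?T" by (simp add: z nbrs_def)
    qed
    show "inj_on ?f ?S"
    proof (rule inj_on_inverseI[where g = "\<lambda>(D, a, b). (D - {{x, a}, {y, b}} \<union> {{x, y}, {a, b}}, a, b)"])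
      fix z assume "z \<in> ?S"
      then obtain D a b where z: "z = (D, a, b)"
        and D: "D \<in> ?G" and e: "{x, y} \<in> D" and Q: "(a, b) \<in> Q D" by auto
      have "{a, b} \<in> D" "{x, a} \<notin> D" "{y, b} \<notin> D" using Q by (auto simp: Q_def nbrs_def)
      with e have "D - {{x, y}, {a, b}} \<union> {{x, a}, {y, b}} - {{x, a}, {y, b}} \<union> {{x, y}, {a, b}} = D"
        by blast
      then show "(\<lambda>(D, a, b). (D - {{x, a}, {y, b}} \<union> {{x, y}, {a, b}}, a, b)) (?f z) = z"
        by (simp add: z)
    qed
  qed
  also have "card ?T = (\<Sum>D\<in>?G. card (nbrs x D) * card (nbrs y D))"
    using finG nb(2) by (subst card_SigmaI) (auto simp: card_cartesian_product)
  also have "\<dots> \<le> card ?G * (d * d)"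
    by (rule order_trans[OF sum_bounded_above[where K = "d * d"]]) (use le_d in \<open>auto intro: mult_le_mono\<close>)
  finally show ?thesis by (simp add: power2_eq_square mult_ac)
qed

section \<open>Percolation on random regular graphs\<close>

text \<open>At most d edges are revealed at v and 1 - p >= 1 / 4, so (1 / 4)^d bounds from below the
  probability that none is retained. The value 16 d^8 is (2 d^2)^4, where 2 d^2 bounds a single
  increment.\<close>

definition rr_\<sigma> :: "nat \<Rightarrow> real" where "rr_\<sigma> d = (1 / 4) ^ d"
definition rr_V :: "nat \<Rightarrow> real" where "rr_V d = 16 * real d ^ 8"
definition rr_b :: "nat \<Rightarrow> real" where "rr_b d = 192 * rr_V d / rr_\<sigma> d"

lemma rr_constants:
  assumes "d \<ge> 1"
  shows "0 < rr_\<sigma> d" "rr_\<sigma> d \<le> 1" "rr_b d \<ge> 192 * rr_V d" "rr_b d \<ge> 2" "rr_\<sigma> d / (6 * rr_b d) \<le> 1"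
proof -
  show \<sigma>: "0 < rr_\<sigma> d" "rr_\<sigma> d \<le> 1" by (simp_all add: rr_\<sigma>_def power_le_one)
  have "real d ^ 8 \<ge> 1" using assms by (intro one_le_power) simp
  then have V: "rr_V d \<ge> 16" by (simp add: rr_V_def)
  have "192 * rr_V d * rr_\<sigma> d \<le> 192 * rr_V d * 1" using \<sigma> V by (intro mult_left_mono) auto
  then show b: "rr_b d \<ge> 192 * rr_V d" using \<sigma> by (simp add: rr_b_def pos_le_divide_eq)
  then show "rr_b d \<ge> 2" using V by simp
  then show "rr_\<sigma> d / (6 * rr_b d) \<le> 1" using \<sigma> by (simp add: divide_le_eq)
qed

text \<open>The vertices at which a hit disturbs the drift: those that have lost a half-edge to an
  earlier revelation, even if that edge was not retained, and the active ones.\<close>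

definition touched :: "nat \<Rightarrow> nat set \<Rightarrow> (nat \<Rightarrow> nat) \<Rightarrow> nat set \<Rightarrow> nat set" where
  "touched d V r Act = {w \<in> V. r w \<noteq> d \<or> w \<in> Act}"

text \<open>A balance of half-edges: v gives up all of its own, an active neighbour loses one
  whether or not the edge is retained, and a newly activated w brings r w - 1. Membership in
  \<open>nsets\<close> makes the subtraction in \<open>rdec\<close> exact.\<close>

lemma sum_rdec:
  assumes fin: "finite V" and Act: "Act \<subseteq> V" and v: "v \<in> Act" and N: "N \<in> nsets V r v" and M: "M \<subseteq> N"
  shows "real (\<Sum>a\<in>Act - {v} \<union> M. rdec r N a)
    = real (\<Sum>a\<in>Act. r a) + ((\<Sum>w\<in>M. if w \<in> Act then 0 else real (r w) - 1) - real (r v) - real (card (N \<inter> Act)))"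
proof -
  have NV: "N \<subseteq> V - {v}" and pos: "\<And>w. w \<in> N \<Longrightarrow> r w > 0" using N by (auto simp: nsets_def)
  have fins: "finite Act" "finite M" "finite N"
    using fin Act M NV by (auto intro: finite_subset)
  have rd: "real (rdec r N a) = real (r a) - (if a \<in> N then 1 else 0)" for a
    using pos[of a] by (auto simp: rdec_def of_nat_diff)
  have "Act - {v} \<union> M = (Act - {v}) \<union> (M - Act)" using M NV by auto
  moreover have "(Act - {v}) \<inter> (M - Act) = {}" by auto
  ultimately have "real (\<Sum>a\<in>Act - {v} \<union> M. rdec r N a)
     = (\<Sum>a\<in>Act - {v}. real (rdec r N a)) + (\<Sum>a\<in>M - Act. real (rdec r N a))"
    using fins by (simp add: sum.union_disjoint)
  also have "(\<Sum>a\<in>Act - {v}. real (rdec r N a)) = (\<Sum>a\<in>Act - {v}. real (r a)) - (\<Sum>a\<in>Act - {v}. if a \<in> N then 1 else 0)"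
    unfolding rd by (rule sum_subtractf)
  also have "(\<Sum>a\<in>Act - {v}. if a \<in> N then 1 else 0) = (\<Sum>a\<in>N \<inter> Act. 1::real)"
    by (rule sum.mono_neutral_cong_right) (use fins NV in auto)
  also have "(\<Sum>a\<in>Act - {v}. real (r a)) = (\<Sum>a\<in>Act. real (r a)) - real (r v)"
    using fins v by (simp add: sum_diff1)
  also have "(\<Sum>a\<in>M - Act. real (rdec r N a)) = (\<Sum>w\<in>M. if w \<in> Act then 0 else real (r w) - 1)"
    by (rule sum.mono_neutral_cong_left) (use fins M rd in auto)
  finally show ?thesis by simp
qed

text \<open>An untouched neighbour brings p (d - 1) = 1 + \<theta> on average, so r v of them would
  offset the loss r v up to \<theta> r v. A touched neighbour costs at most 1 + \<theta> <= 2 in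
  missing gain and one lost half-edge, hence the 3.\<close>

lemma mean_increment_ge:
  fixes d :: nat and p \<theta> :: real
  assumes fin: "finite V" and d: "d \<ge> 3" and p: "p = (1 + \<theta>) / (real d - 1)" and \<theta>: "\<bar>\<theta>\<bar> \<le> 1 / 4"
    and N: "N \<in> nsets V r v" and rv: "r v \<le> d"
  shows "(\<Sum>M\<in>Pow N. wt p N M * ((\<Sum>w\<in>M. if w \<in> Act then 0 else real (r w) - 1) - real (r v) - real (card (N \<inter> Act))))
    \<ge> - (\<bar>\<theta>\<bar> * real d + 3 * real (card (N \<inter> touched d V r Act)))"
proof -
  let ?B = "N \<inter> touched d V r Act"
  have NV: "N \<subseteq> V - {v}" and pos: "\<And>w. w \<in> N \<Longrightarrow> r w > 0" and card: "card N = r v"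
    using N by (auto simp: nsets_def)
  have finN: "finite N" using NV fin by (meson finite_Diff finite_subset)
  have p0: "p \<ge> 0" using p \<theta> d by simp
  have pd: "p * (real d - 1) = 1 + \<theta>" using p d by simp
  have "(\<Sum>M\<in>Pow N. wt p N M * ((\<Sum>w\<in>M. if w \<in> Act then 0 else real (r w) - 1) - real (r v) - real (card (N \<inter> Act))))
    = p * (\<Sum>w\<in>N. if w \<in> Act then 0 else real (r w) - 1) - (real (r v) + real (card (N \<inter> Act)))"
    using sum_wt_linear[OF finN, of p "\<lambda>w. if w \<in> Act then 0 else real (r w) - 1"] sum_wt[OF finN, of p]
    by (simp add: right_diff_distrib sum_subtractf distrib_left flip: sum_distrib_right)
  moreover have "(\<Sum>w\<in>N. if w \<in> Act then 0 else real (r w) - 1) \<ge> (\<Sum>w\<in>N - ?B. real d - 1)"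
  proof -
    have "(\<Sum>w\<in>N - ?B. real d - 1) = (\<Sum>w\<in>N - ?B. if w \<in> Act then 0 else real (r w) - 1)"
      using NV by (intro sum.cong) (auto simp: touched_def)
    also have "\<dots> \<le> (\<Sum>w\<in>N. if w \<in> Act then 0 else real (r w) - 1)"
    proof (rule sum_mono2)
      fix w assume "w \<in> N - (N - ?B)"
      then have "r w > 0" using pos by simp
      then show "0 \<le> (if w \<in> Act then 0 else real (r w) - 1)" by simp
    qed (use finN in auto)
    finally show ?thesis .
  qed
  moreover have "(\<Sum>w\<in>N - ?B. real d - 1) = (real (r v) - real (card ?B)) * (real d - 1)"
    using finN by (simp add: card_Diff_subset card card_mono of_nat_diff flip: card)
  ultimately have "(\<Sum>M\<in>Pow N. wt p N M * ((\<Sum>w\<in>M. if w \<in> Act then 0 else real (r w) - 1) - real (r v) - real (card (N \<inter> Act))))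
    \<ge> p * ((real (r v) - real (card ?B)) * (real d - 1)) - (real (r v) + real (card (N \<inter> Act)))"
    using mult_left_mono[OF _ p0] by (smt (verit))
  also have "p * ((real (r v) - real (card ?B)) * (real d - 1)) = (1 + \<theta>) * (real (r v) - real (card ?B))"
    using pd by (simp add: mult_ac)
  finally have 1: "(\<Sum>M\<in>Pow N. wt p N M * ((\<Sum>w\<in>M. if w \<in> Act then 0 else real (r w) - 1) - real (r v) - real (card (N \<inter> Act))))
    \<ge> (1 + \<theta>) * (real (r v) - real (card ?B)) - (real (r v) + real (card (N \<inter> Act)))" .
  have "card (N \<inter> Act) \<le> card ?B"
    using finN NV by (intro card_mono) (auto simp: touched_def)
  moreover have "\<theta> * real (r v) \<ge> - (\<bar>\<theta>\<bar> * real d)"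
  proof -
    have "\<bar>\<theta> * real (r v)\<bar> \<le> \<bar>\<theta>\<bar> * real d" using rv by (simp add: abs_mult mult_left_mono)
    then show ?thesis by linarith
  qed
  moreover have "\<theta> * real (card ?B) \<le> 1 * real (card ?B)" using \<theta> by (intro mult_right_mono) auto
  ultimately have "(1 + \<theta>) * (real (r v) - real (card ?B)) - (real (r v) + real (card (N \<inter> Act)))
    \<ge> - (\<bar>\<theta>\<bar> * real d + 3 * real (card ?B))"
    by (simp add: algebra_simps)
  with 1 show ?thesis by linarith
qed

text \<open>By linearity the mean number of neighbours of v in B is a sum of edge probabilities,
  each bounded by the switching estimate.\<close>

lemma sum_card_Int_le:
  fixes \<zeta> :: real
  assumes fin: "finite V" and v: "v \<in> V" and r: "\<And>u. u \<in> V \<Longrightarrow> r u \<le> d" and B: "B \<subseteq> V"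
    and M: "real (\<Sum>u\<in>V. r u) - 2 * real d * (real d + 1) > 0"
    and \<zeta>: "(real d)\<^sup>2 * real (card B) \<le> \<zeta> * (real (\<Sum>u\<in>V. r u) - 2 * real d * (real d + 1))"
  shows "(\<Sum>N\<in>nsets V r v. real (card (rgraphs (V - {v}) (rdec r N))) * real (card (N \<inter> B)))
    \<le> \<zeta> * real (card (rgraphs V r))"
proof -
  let ?m = "real (\<Sum>u\<in>V. r u) - 2 * real d * (real d + 1)"
  let ?G = "rgraphs V r"
  have finB: "finite B" using B fin finite_subset by blast
  have "(\<Sum>N\<in>nsets V r v. real (card (rgraphs (V - {v}) (rdec r N))) * real (card (N \<inter> B)))
    = (\<Sum>N\<in>nsets V r v. \<Sum>D\<in>rgraphs (V - {v}) (rdec r N). real (card (nbrs v (star v N \<union> D) \<inter> B)))"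
  proof (rule sum.cong[OF refl])
    fix N
    have "(\<Sum>D\<in>rgraphs (V - {v}) (rdec r N). real (card (nbrs v (star v N \<union> D) \<inter> B)))
      = (\<Sum>D\<in>rgraphs (V - {v}) (rdec r N). real (card (N \<inter> B)))"
      by (rule sum.cong) (auto simp: rgraphs_def nbrs_star_Un)
    then show "real (card (rgraphs (V - {v}) (rdec r N))) * real (card (N \<inter> B))
      = (\<Sum>D\<in>rgraphs (V - {v}) (rdec r N). real (card (nbrs v (star v N \<union> D) \<inter> B)))" by simp
  qed
  also have "\<dots> = (\<Sum>D\<in>?G. real (card (nbrs v D \<inter> B)))"
    using sum_rgraphs[OF fin v, of "\<lambda>D. real (card (nbrs v D \<inter> B))" r] by simp
  also have "\<dots> = (\<Sum>D\<in>?G. \<Sum>b\<in>B. if {v, b} \<in> D then 1 else 0)"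
  proof (rule sum.cong[OF refl])
    fix D
    have "(\<Sum>b\<in>B. if {v, b} \<in> D then 1 else 0) = (\<Sum>b\<in>nbrs v D \<inter> B. 1::real)"
      by (rule sum.mono_neutral_cong_right) (use finB in \<open>auto simp: nbrs_def\<close>)
    then show "real (card (nbrs v D \<inter> B)) = (\<Sum>b\<in>B. if {v, b} \<in> D then 1 else 0)" by simp
  qed
  also have "\<dots> = (\<Sum>b\<in>B. \<Sum>D\<in>?G. if {v, b} \<in> D then 1 else 0)" by (rule sum.swap)
  also have "\<dots> = (\<Sum>b\<in>B. real (card {D \<in> ?G. {v, b} \<in> D}))"
  proof (rule sum.cong[OF refl])
    fix b
    have "(\<Sum>D\<in>?G. if {v, b} \<in> D then 1 else 0) = (\<Sum>D\<in>{D \<in> ?G. {v, b} \<in> D}. 1::real)"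
      by (rule sum.mono_neutral_cong_right) (auto simp: finite_rgraphs[OF fin])
    then show "(\<Sum>D\<in>?G. if {v, b} \<in> D then 1 else 0) = real (card {D \<in> ?G. {v, b} \<in> D})" by simp
  qed
  also have "\<dots> \<le> real (card B) * ((real d)\<^sup>2 * real (card ?G) / ?m)"
  proof (rule sum_bounded_above)
    fix b
    show "real (card {D \<in> ?G. {v, b} \<in> D}) \<le> (real d)\<^sup>2 * real (card ?G) / ?m"
      using card_rgraphs_edge_le[OF fin r, where x = v and y = b] M by (simp add: pos_le_divide_eq)
  qed
  also have "\<dots> = ((real d)\<^sup>2 * real (card B) / ?m) * real (card ?G)" by simp
  also have "\<dots> \<le> \<zeta> * real (card ?G)"
    using \<zeta> M by (intro mult_right_mono) (auto simp: pos_divide_le_eq)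
  finally show ?thesis .
qed

text \<open>The step is indexed by pairs (N, M), with N weighted by the number of graphs completing
  it. Active vertices are touched, so hits of them are already counted in \<zeta> and \<nu> = 0
  works. With r v >= 1 the choice M = {} moves the walk by at least 1 in absolute value, which
  supplies the variance.\<close>

lemma rr_step:
  fixes d K s :: nat and p \<theta> \<zeta> :: real
  assumes V: "finite V" "Act \<subseteq> V" "v \<in> Act" and rv: "r v \<ge> 1" and r: "\<And>u. u \<in> V \<Longrightarrow> r u \<le> d"
    and d: "d \<ge> 3" and p: "p = (1 + \<theta>) / (real d - 1)" and \<theta>: "\<bar>\<theta>\<bar> \<le> 1 / 4"
    and K: "K \<ge> 1" "s \<le> K"
    and M: "real (\<Sum>u\<in>V. r u) - 2 * real d * (real d + 1) > 0"
    and \<zeta>: "(real d)\<^sup>2 * real (card (touched d V r Act)) \<le> \<zeta> * (real (\<Sum>u\<in>V. r u) - 2 * real d * (real d + 1))"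
    and \<mu>: "(\<bar>\<theta>\<bar> * real d + 3 * \<zeta>)\<^sup>2 * real K \<le> rr_\<sigma> d / 96"
  shows "(\<Sum>N\<in>nsets V r v. \<Sum>M\<in>Pow N. wt p N M * real (card (rgraphs (V - {v}) (rdec r N)))
        * lyap (rr_b d) K (real (\<Sum>a\<in>Act - {v} \<union> M. rdec r N a)) (real s + 1))
    \<le> (1 - rr_\<sigma> d / (6 * rr_b d) / K) * (real (card (rgraphs V r)) * lyap (rr_b d) K (real (\<Sum>a\<in>Act. r a)) s)"
proof -
  let ?g = "\<lambda>N. real (card (rgraphs (V - {v}) (rdec r N)))"
  let ?h = "\<lambda>N M. (\<Sum>w\<in>M. if w \<in> Act then 0 else real (r w) - 1) - real (r v) - real (card (N \<inter> Act))"
  let ?I = "Sigma (nsets V r v) Pow"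
  let ?w = "\<lambda>(N, M). wt p N M * ?g N"
  let ?\<xi> = "\<lambda>(N, M). ?h N M"
  have vV: "v \<in> V" using V by auto
  have p01: "0 \<le> p" "p \<le> 3 / 4"
    using d \<theta> by (auto simp: p field_simps)
  have finN: "finite N" if "N \<in> nsets V r v" for N
    using that V(1) by (auto simp: nsets_def intro: finite_subset)
  have fin: "finite (nsets V r v)" by (rule finite_nsets[OF V(1)])
  have Sig: "(\<Sum>(N, M)\<in>?I. f N M) = (\<Sum>N\<in>nsets V r v. \<Sum>M\<in>Pow N. f N M)" for f :: "nat set \<Rightarrow> nat set \<Rightarrow> real"
    using fin finN by (subst sum.Sigma) auto
  have SigW: "(\<Sum>i\<in>?I. ?w i * f i) = (\<Sum>N\<in>nsets V r v. ?g N * (\<Sum>M\<in>Pow N. wt p N M * f (N, M)))"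
    for f :: "nat set \<times> nat set \<Rightarrow> real"
    using Sig[of "\<lambda>N M. wt p N M * ?g N * f (N, M)"]
    by (simp add: sum_distrib_left case_prod_beta mult_ac)
  have gsum: "(\<Sum>N\<in>nsets V r v. ?g N) = real (card (rgraphs V r))"
    using sum_rgraphs[OF V(1) vV, of "\<lambda>_. 1" r] by simp
  have wsum: "sum ?w ?I = real (card (rgraphs V r))"
    using SigW[of "\<lambda>_. 1"] sum_wt[OF finN] gsum by simp
  have hb: "\<bar>?h N M\<bar> \<le> 2 * (real d)\<^sup>2" if "N \<in> nsets V r v" "M \<subseteq> N" for N M
  proof -
    have NV: "N \<subseteq> V - {v}" and pos: "\<And>w. w \<in> N \<Longrightarrow> r w > 0" and card: "card N = r v"
      using that(1) by (auto simp: nsets_def)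
    have rvd: "r v \<le> d" using r vV .
    have cM: "card M \<le> d" using card_mono[OF finN[OF that(1)] that(2)] card rvd by simp
    have cA: "card (N \<inter> Act) \<le> d" using card_mono[OF finN[OF that(1)], of "N \<inter> Act"] card rvd by simp
    have lo: "0 \<le> (\<Sum>w\<in>M. if w \<in> Act then 0 else real (r w) - 1)"
    proof (rule sum_nonneg)
      fix w assume "w \<in> M"
      then have "r w > 0" using pos that by auto
      then show "0 \<le> (if w \<in> Act then 0 else real (r w) - 1)" by simp
    qed
    have "(\<Sum>w\<in>M. if w \<in> Act then 0 else real (r w) - 1) \<le> real (card M) * real d"
    proof (rule sum_bounded_above)
      fix w assume "w \<in> M"
      then have "r w \<le> d" using r that NV by auto
      then show "(if w \<in> Act then 0 else real (r w) - 1) \<le> real d" by simp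
    qed
    also have "\<dots> \<le> real d * real d" using cM by (intro mult_right_mono) auto
    finally have hi: "(\<Sum>w\<in>M. if w \<in> Act then 0 else real (r w) - 1) \<le> real d * real d" .
    have "real d * 1 \<le> real d * real d" using d by (intro mult_left_mono) auto
    then show ?thesis using lo hi cA rvd by (simp add: power2_eq_square abs_le_iff)
  qed
  have "(\<Sum>i\<in>?I. ?w i * lyap (rr_b d) K (real (\<Sum>a\<in>Act. r a) + ?\<xi> i) (real s + 1))
    \<le> (1 - rr_\<sigma> d / (6 * rr_b d) / K) * (sum ?w ?I * lyap (rr_b d) K (real (\<Sum>a\<in>Act. r a)) s)"
  proof (rule lyap_step[where \<mu> = "\<bar>\<theta>\<bar> * real d + 3 * \<zeta>" and \<nu> = 0 and V = "rr_V d"])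
    show "finite ?I" using fin finN by auto
    show w0: "0 \<le> ?w i" if "i \<in> ?I" for i using p01 by (auto simp: wt_nonneg split: prod.split)
    have "- (\<bar>\<theta>\<bar> * real d + 3 * \<zeta>) * real (card (rgraphs V r))
      \<le> - (\<bar>\<theta>\<bar> * real d) * (\<Sum>N\<in>nsets V r v. ?g N) - 3 * (\<Sum>N\<in>nsets V r v. ?g N * real (card (N \<inter> touched d V r Act)))"
      using sum_card_Int_le[OF V(1) vV r _ M \<zeta>] unfolding gsum
      by (simp add: touched_def algebra_simps)
    also have "\<dots> = (\<Sum>N\<in>nsets V r v. ?g N * (- (\<bar>\<theta>\<bar> * real d + 3 * real (card (N \<inter> touched d V r Act)))))"
      by (simp add: sum_distrib_left sum_distrib_right sum.distrib sum_subtractf sum_negf algebra_simps)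
    also have "\<dots> \<le> (\<Sum>N\<in>nsets V r v. ?g N * (\<Sum>M\<in>Pow N. wt p N M * ?h N M))"
      by (intro sum_mono mult_left_mono mean_increment_ge V(1) d p \<theta> r vV) auto
    finally show "- (\<bar>\<theta>\<bar> * real d + 3 * \<zeta> + 0 * real (\<Sum>a\<in>Act. r a)) * sum ?w ?I \<le> (\<Sum>i\<in>?I. ?w i * ?\<xi> i)"
      unfolding SigW wsum by simp
    have "rr_\<sigma> d * (\<Sum>N\<in>nsets V r v. ?g N) \<le> (\<Sum>N\<in>nsets V r v. ?g N * (\<Sum>M\<in>Pow N. wt p N M * (?h N M)\<^sup>2))"
    proof (subst sum_distrib_left, rule sum_mono)
      fix N assume N: "N \<in> nsets V r v"
      have cN: "card N = r v" using N by (simp add: nsets_def)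
      have "(1 / 4 :: real) ^ d \<le> (1 / 4) ^ card N" using r vV cN by (intro power_decreasing) auto
      also have "\<dots> \<le> (1 - p) ^ card N" using p01 by (intro power_mono) auto
      also have "\<dots> * 1 \<le> (1 - p) ^ card N * (?h N {})\<^sup>2"
      proof (rule mult_left_mono)
        have "1 \<le> real (r v) + real (card (N \<inter> Act))" using rv by simp
        then have "1\<^sup>2 \<le> (real (r v) + real (card (N \<inter> Act)))\<^sup>2" by (intro power_mono) auto
        also have "\<dots> = (?h N {})\<^sup>2" by (simp add: power2_eq_square algebra_simps)
        finally show "1 \<le> (?h N {})\<^sup>2" by simp
      qed (use p01 in simp)
      also have "\<dots> = wt p N {} * (?h N {})\<^sup>2" by (simp add: wt_def)
      also have "\<dots> \<le> (\<Sum>M\<in>Pow N. wt p N M * (?h N M)\<^sup>2)"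
        using finN[OF N] p01 wt_nonneg[of p N] by (intro member_le_sum) auto
      finally have "rr_\<sigma> d \<le> (\<Sum>M\<in>Pow N. wt p N M * (?h N M)\<^sup>2)" by (simp add: rr_\<sigma>_def)
      from mult_left_mono[OF this, of "?g N"]
      show "rr_\<sigma> d * ?g N \<le> ?g N * (\<Sum>M\<in>Pow N. wt p N M * (?h N M)\<^sup>2)" by (simp add: mult.commute)
    qed
    then show "rr_\<sigma> d * sum ?w ?I \<le> (\<Sum>i\<in>?I. ?w i * (?\<xi> i)\<^sup>2)"
      unfolding SigW wsum gsum by simp
    have bound: "(\<Sum>i\<in>?I. ?w i * f i) \<le> rr_V d * sum ?w ?I"
      if "\<And>N M. N \<in> nsets V r v \<Longrightarrow> M \<subseteq> N \<Longrightarrow> f (N, M) \<le> rr_V d" for f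
    proof -
      have "(\<Sum>i\<in>?I. ?w i * f i) \<le> (\<Sum>i\<in>?I. ?w i * rr_V d)"
        using that by (intro sum_mono mult_left_mono w0) auto
      also have "\<dots> = rr_V d * sum ?w ?I"
        by (subst sum_distrib_right[symmetric]) (rule mult.commute)
      finally show ?thesis .
    qed
    have d8: "(2 * (real d)\<^sup>2) ^ 4 = rr_V d"
      by (simp add: rr_V_def power_mult_distrib flip: power_mult)
    have "1 \<le> (real d)\<^sup>2" using d by (intro one_le_power) simp
    then have "2 * (real d)\<^sup>2 \<ge> 1" by simp
    then have d4: "(2 * (real d)\<^sup>2) ^ 2 \<le> rr_V d"
      unfolding d8[symmetric] by (intro power_increasing) auto
    show "(\<Sum>i\<in>?I. ?w i * (?\<xi> i)\<^sup>2) \<le> rr_V d * sum ?w ?I"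
    proof (rule bound)
      fix N M assume "N \<in> nsets V r v" "M \<subseteq> N"
      then have "\<bar>?h N M\<bar> ^ 2 \<le> (2 * (real d)\<^sup>2) ^ 2" by (intro power_mono hb) auto
      then show "(case (N, M) of (N, M) \<Rightarrow> ?h N M)\<^sup>2 \<le> rr_V d" using d4 by simp
    qed
    show "(\<Sum>i\<in>?I. ?w i * ?\<xi> i ^ 4) \<le> rr_V d * sum ?w ?I"
    proof (rule bound)
      fix N M assume "N \<in> nsets V r v" "M \<subseteq> N"
      then have "\<bar>?h N M\<bar> ^ 4 \<le> (2 * (real d)\<^sup>2) ^ 4" by (intro power_mono hb) auto
      then show "(case (N, M) of (N, M) \<Rightarrow> ?h N M) ^ 4 \<le> rr_V d" using d8 by simp
    qed
  qed (use K \<mu> rr_constants[of d] d in \<open>auto simp: rr_b_def sum_nonneg\<close>)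
  also have "(\<Sum>i\<in>?I. ?w i * lyap (rr_b d) K (real (\<Sum>a\<in>Act. r a) + ?\<xi> i) (real s + 1))
     = (\<Sum>i\<in>?I. case i of (N, M) \<Rightarrow> wt p N M * ?g N * lyap (rr_b d) K (real (\<Sum>a\<in>Act - {v} \<union> M. rdec r N a)) (real s + 1))"
  proof (rule sum.cong[OF refl])
    fix i assume "i \<in> ?I"
    then obtain N M where i: "i = (N, M)" and NM: "N \<in> nsets V r v" "M \<subseteq> N" by auto
    show "?w i * lyap (rr_b d) K (real (\<Sum>a\<in>Act. r a) + ?\<xi> i) (real s + 1)
      = (case i of (N, M) \<Rightarrow> wt p N M * ?g N * lyap (rr_b d) K (real (\<Sum>a\<in>Act - {v} \<union> M. rdec r N a)) (real s + 1))"
      unfolding i prod.case sum_rdec[OF V NM] ..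
  qed
  also have "\<dots> = (\<Sum>N\<in>nsets V r v. \<Sum>M\<in>Pow N. wt p N M * ?g N
      * lyap (rr_b d) K (real (\<Sum>a\<in>Act - {v} \<union> M. rdec r N a)) (real s + 1))"
    by (rule Sig)
  finally show ?thesis unfolding wsum .
qed


text \<open>A step touches at most d neighbours and, at a restart, one start vertex, so at most (d +
  1) T vertices are ever touched. The value \<zeta> solves d^2 (d + 1) T = \<zeta> d n / 2, where d
  n / 2 is a lower bound for the denominator of the switching estimate.\<close>

lemma rr_small_prob_le:
  fixes n d T K :: nat and p \<theta> :: real
  assumes d: "d \<ge> 3" and p: "p = (1 + \<theta>) / (real d - 1)" and \<theta>: "\<bar>\<theta>\<bar> \<le> 1 / 4"
    and K: "K \<ge> 1" and n: "8 * (d + 1) \<le> n" and T: "4 * (d + 2) * T \<le> n"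
    and \<mu>: "(\<bar>\<theta>\<bar> * real d + 3 * (2 * real d * (real d + 1) * real T / real n))\<^sup>2 * real K \<le> rr_\<sigma> d / 96"
  shows "gndp_prob n d p (\<lambda>E. cmax n E < K) \<le> 3 * exp (- (rr_\<sigma> d / (6 * rr_b d)) * real T / real K)"
proof -
  define \<rho> where "\<rho> = 1 - rr_\<sigma> d / (6 * rr_b d) / K"
  define \<zeta> where "\<zeta> = 2 * real d * (real d + 1) * real T / real n"
  define X where "X r Act = real (\<Sum>a\<in>Act. r a)" for r :: "nat \<Rightarrow> nat" and Act :: "nat set"
  have p01: "0 \<le> p" "p \<le> 1"
    using d \<theta> by (auto simp: p field_simps)
  have d1: "d \<ge> 1" using d by simp
  have \<kappa>: "rr_\<sigma> d / (6 * rr_b d) / K \<le> 1"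
  proof -
    have "rr_\<sigma> d / (6 * rr_b d) / K \<le> 1 / K" by (rule divide_right_mono[OF rr_constants(5)[OF d1]]) simp
    also have "\<dots> \<le> 1" using K by simp
    finally show ?thesis .
  qed
  then have \<rho>: "\<rho> \<ge> 0" by (simp add: \<rho>_def)
  have bK: "rr_b d > 0" "real K > 0" using rr_constants(4)[OF d1] K by auto
  have n0: "n > 0" using n by simp
  have main: "(\<Sum>D\<in>rgraphs V r. perc p D (\<lambda>E. small K E Act s))
      \<le> real (card (rgraphs V r)) * (\<rho> ^ t * lyap (rr_b d) K (X r Act) s)"
    if "finite V" "card V + T = n + t" "t \<le> T" "Act \<subseteq> V" "s \<le> K" "\<And>u. u \<in> V \<Longrightarrow> r u \<le> d"
      "card (touched d V r Act) + (d + 1) * t \<le> (d + 1) * T" for t V Act s r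
    using that
  proof (induction t arbitrary: V Act s r)
    case 0
    have "(\<Sum>D\<in>rgraphs V r. perc p D (\<lambda>E. small K E Act s)) \<le> real (card (rgraphs V r)) * 1"
    proof (rule sum_bounded_above)
      fix D assume "D \<in> rgraphs V r"
      then have "finite D" using finite_pairs[OF 0(1)] by (auto simp: rgraphs_def intro: finite_subset)
      then show "perc p D (\<lambda>E. small K E Act s) \<le> 1" by (rule perc_le_1[OF p01])
    qed
    also have "\<dots> \<le> real (card (rgraphs V r)) * (\<rho> ^ 0 * lyap (rr_b d) K (X r Act) s)"
      using 0 bK lyap_ge_1[of s K "rr_b d" "X r Act"] by (intro mult_left_mono) auto
    finally show ?case .
  next
    case (Suc t)
    note fin = Suc.prems(1)
    \<comment> \<open>Of the d + 1 touched vertices allowed per step, d are kept for the neighbours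
      of v; the remaining one may already have been spent on v as a new start vertex.\<close>
    have act: "(\<Sum>D\<in>rgraphs V r. perc p D (\<lambda>E. small K E Act s))
      \<le> real (card (rgraphs V r)) * (\<rho> ^ Suc t * lyap (rr_b d) K (X r Act) s)"
      if v: "v \<in> Act" "Act \<subseteq> V" and rv: "r v \<ge> 1" and s: "s \<le> K"
        and B: "card (touched d V r Act) + d + (d + 1) * t \<le> (d + 1) * T" for v Act s
    proof (cases "s < K")
      case False
      then have "perc p D (\<lambda>E. small K E Act s) = 0" for D
        using small_less by (auto simp: perc_def intro!: sum.neutral)
      moreover have "0 \<le> real (card (rgraphs V r)) * (\<rho> ^ Suc t * lyap (rr_b d) K (X r Act) s)"
        using \<rho> lyap_ge_1[of s K "rr_b d" "X r Act"] bK s by (intro mult_nonneg_nonneg) auto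
      ultimately show ?thesis by simp
    next
      case True
      let ?W = "V - {v}"
      let ?g = "\<lambda>N. real (card (rgraphs ?W (rdec r N)))"
      have vV: "v \<in> V" using v by auto
      have "(\<Sum>D\<in>rgraphs V r. perc p D (\<lambda>E. small K E Act s))
        = (\<Sum>N\<in>nsets V r v. \<Sum>D\<in>rgraphs ?W (rdec r N). perc p (star v N \<union> D) (\<lambda>E. small K E Act s))"
        by (rule sum_rgraphs[OF fin vV])
      also have "\<dots> = (\<Sum>N\<in>nsets V r v. \<Sum>D\<in>rgraphs ?W (rdec r N).
          \<Sum>M\<in>Pow N. wt p N M * perc p D (\<lambda>E. small K (star v M \<union> E) Act s))"
        by (intro sum.cong refl perc_star_Un[OF fin]) (auto simp: nsets_def rgraphs_def)
      also have "\<dots> = (\<Sum>N\<in>nsets V r v. \<Sum>M\<in>Pow N.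
          wt p N M * (\<Sum>D\<in>rgraphs ?W (rdec r N). perc p D (\<lambda>E. small K (star v M \<union> E) Act s)))"
        unfolding sum_distrib_left by (intro sum.cong refl sum.swap)
      also have "\<dots> \<le> (\<Sum>N\<in>nsets V r v. \<Sum>M\<in>Pow N.
          wt p N M * (?g N * (\<rho> ^ t * lyap (rr_b d) K (X (rdec r N) (Act - {v} \<union> M)) (Suc s))))"
      proof (intro sum_mono mult_left_mono wt_nonneg p01)
        fix N M assume N: "N \<in> nsets V r v" and M: "M \<in> Pow N"
        have NV: "N \<subseteq> V - {v}" and cN: "card N = r v" using N by (auto simp: nsets_def)
        have "(\<Sum>D\<in>rgraphs ?W (rdec r N). perc p D (\<lambda>E. small K (star v M \<union> E) Act s))
          \<le> (\<Sum>D\<in>rgraphs ?W (rdec r N). perc p D (\<lambda>E. small K E (Act - {v} \<union> M) (Suc s)))"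
        proof (intro sum_mono perc_mono p01)
          fix D E assume "D \<in> rgraphs ?W (rdec r N)" "E \<subseteq> D" "small K (star v M \<union> E) Act s"
          then show "small K E (Act - {v} \<union> M) (Suc s)"
            using M NV by (intro small_step[OF fin v]) (auto simp: rgraphs_def)
        qed
        also have "\<dots> \<le> ?g N * (\<rho> ^ t * lyap (rr_b d) K (X (rdec r N) (Act - {v} \<union> M)) (Suc s))"
        proof (rule Suc.IH)
          show "finite ?W" using fin by simp
          have "card V = Suc (card ?W)" using vV fin by (metis card_Suc_Diff1)
          then show "card ?W + T = n + t" using Suc.prems by simp
          show "t \<le> T" "Suc s \<le> K" using Suc.prems True by auto
          show "Act - {v} \<union> M \<subseteq> ?W" using v M NV by auto
          show "rdec r N u \<le> d" if "u \<in> ?W" for u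
            using Suc.prems(6)[of u] that by (auto simp: rdec_def)
          have finN: "finite N" using NV fin by (meson finite_Diff finite_subset)
          have "touched d ?W (rdec r N) (Act - {v} \<union> M) \<subseteq> touched d V r Act \<union> N"
            using M by (auto simp: touched_def rdec_def)
          then have "card (touched d ?W (rdec r N) (Act - {v} \<union> M)) \<le> card (touched d V r Act \<union> N)"
            using fin finN by (intro card_mono) (auto simp: touched_def)
          also have "\<dots> \<le> card (touched d V r Act) + card N" by (rule card_Un_le)
          also have "card N \<le> d" using cN Suc.prems(6)[OF vV] by simp
          finally show "card (touched d ?W (rdec r N) (Act - {v} \<union> M)) + (d + 1) * t \<le> (d + 1) * T"
            using B by linarith
        qed
        finally show "(\<Sum>D\<in>rgraphs ?W (rdec r N). perc p D (\<lambda>E. small K (star v M \<union> E) Act s))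
          \<le> ?g N * (\<rho> ^ t * lyap (rr_b d) K (X (rdec r N) (Act - {v} \<union> M)) (Suc s))" .
      qed
      also have "\<dots> = \<rho> ^ t * (\<Sum>N\<in>nsets V r v. \<Sum>M\<in>Pow N. wt p N M * ?g N
          * lyap (rr_b d) K (X (rdec r N) (Act - {v} \<union> M)) (real s + 1))"
        by (simp add: sum_distrib_left mult_ac add.commute)
      also have "\<dots> \<le> \<rho> ^ t * (\<rho> * (real (card (rgraphs V r)) * lyap (rr_b d) K (X r Act) s))"
      proof (rule mult_left_mono)
        have Tn: "4 * (real d + 2) * real T \<le> real n" "8 * (real d + 1) \<le> real n"
          using of_nat_mono[OF T, where ?'a = real] of_nat_mono[OF n, where ?'a = real]
          by (simp_all add: algebra_simps)
        have cB: "card (touched d V r Act) \<le> (d + 1) * T" using B by linarith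
        then have cB': "real (card (touched d V r Act)) \<le> (real d + 1) * real T"
          using of_nat_mono[OF cB, where ?'a = real] by (simp add: algebra_simps)
        \<comment> \<open>At least n - (d + 2) T vertices are present and untouched, each of full
          degree d. This gives 3 d n / 4, of which the correction 2 d (d + 1) takes at most d n /
          4.\<close>
        have m: "real (\<Sum>u\<in>V. r u) - 2 * real d * (real d + 1) \<ge> real d * real n / 2"
        proof -
          have "real d * (real (card V) - real (card (touched d V r Act))) = (\<Sum>u\<in>V - touched d V r Act. real d)"
          proof -
            have "touched d V r Act \<subseteq> V" by (auto simp: touched_def)
            then show ?thesis using fin by (simp add: card_Diff_subset card_mono of_nat_diff finite_subset mult.commute)
          qed
          also have "\<dots> = (\<Sum>u\<in>V - touched d V r Act. real (r u))"
            by (rule sum.cong) (auto simp: touched_def)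
          also have "\<dots> \<le> (\<Sum>u\<in>V. real (r u))" using fin by (intro sum_mono2) auto
          finally have "real d * (real (card V) - real (card (touched d V r Act))) \<le> real (\<Sum>u\<in>V. r u)" by simp
          moreover have "real d * (real n - (real d + 2) * real T) \<le> real d * (real (card V) - real (card (touched d V r Act)))"
          proof (rule mult_left_mono)
            have "real (card V) + real T = real n + real (Suc t)"
              using Suc.prems(2) by (simp flip: of_nat_add)
            then show "real n - (real d + 2) * real T \<le> real (card V) - real (card (touched d V r Act))"
              using cB' by (simp add: algebra_simps)
          qed simp
          moreover have "real d * (3 / 4 * real n) \<le> real d * (real n - (real d + 2) * real T)"
            using Tn by (intro mult_left_mono) (auto simp: algebra_simps)
          moreover have "real d * (2 * (real d + 1)) \<le> real d * (real n / 4)"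
            using Tn by (intro mult_left_mono) auto
          ultimately show ?thesis by (simp add: algebra_simps)
        qed
        have m0: "real d * real n / 2 > 0" using d n0 by simp
        show "(\<Sum>N\<in>nsets V r v. \<Sum>M\<in>Pow N. wt p N M * ?g N
            * lyap (rr_b d) K (X (rdec r N) (Act - {v} \<union> M)) (real s + 1))
          \<le> \<rho> * (real (card (rgraphs V r)) * lyap (rr_b d) K (X r Act) s)"
          unfolding \<rho>_def X_def
        proof (rule rr_step[where \<theta> = \<theta> and \<zeta> = \<zeta>])
          show "real (\<Sum>u\<in>V. r u) - 2 * real d * (real d + 1) > 0" using m m0 by linarith
          have \<zeta>0: "\<zeta> \<ge> 0" by (simp add: \<zeta>_def)
          have "(real d)\<^sup>2 * real (card (touched d V r Act)) \<le> (real d)\<^sup>2 * ((real d + 1) * real T)"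
            using cB' by (intro mult_left_mono) auto
          also have "\<dots> = \<zeta> * (real d * real n / 2)"
            using n0 by (simp add: \<zeta>_def field_simps power2_eq_square)
          also have "\<dots> \<le> \<zeta> * (real (\<Sum>u\<in>V. r u) - 2 * real d * (real d + 1))"
            using m \<zeta>0 by (rule mult_left_mono)
          finally show "(real d)\<^sup>2 * real (card (touched d V r Act))
            \<le> \<zeta> * (real (\<Sum>u\<in>V. r u) - 2 * real d * (real d + 1))" .
          show "(\<bar>\<theta>\<bar> * real d + 3 * \<zeta>)\<^sup>2 * real K \<le> rr_\<sigma> d / 96"
            using \<mu> by (simp add: \<zeta>_def)
        qed (use fin v rv s K d p \<theta> Suc.prems(6) in auto)
      qed (use \<rho> in simp)
      finally show ?thesis by (simp add: mult_ac)
    qed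
    show ?case
    \<comment> \<open>The split is on half-edges and not on \<open>Act = {}\<close>: active vertices
      may remain whose edges have all been revealed, and the restart abandons them. The new start
      vertex is chosen untouched, so that it has d half-edges.\<close>
    proof (cases "X r Act = 0")
      case False
      then have "(\<Sum>a\<in>Act. r a) \<noteq> 0" by (metis X_def of_nat_0)
      then obtain v where "v \<in> Act" "r v \<noteq> 0" by (metis sum.neutral)
      then show ?thesis using act[of v Act s] Suc.prems by simp
    next
      case True
      have B: "card (touched d V r Act) + (d + 1) * (t + 1) \<le> (d + 1) * T" using Suc.prems by simp
      have "card (touched d V r Act) < card V"
      proof -
        have "(d + 2) * T \<le> n" using T by (simp add: algebra_simps)
        then show ?thesis using B Suc.prems(2) by (simp add: algebra_simps)
      qed
      moreover have "touched d V r Act \<subseteq> V" by (auto simp: touched_def)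
      ultimately have "touched d V r Act \<subset> V" by auto
      then obtain v where v: "v \<in> V" "v \<notin> touched d V r Act" by blast
      then have rv: "r v = d" by (simp add: touched_def)
      have "(\<Sum>D\<in>rgraphs V r. perc p D (\<lambda>E. small K E Act s))
        \<le> (\<Sum>D\<in>rgraphs V r. perc p D (\<lambda>E. small K E {v} 0))"
        using small_restart by (intro sum_mono perc_mono p01)
      also have "\<dots> \<le> real (card (rgraphs V r)) * (\<rho> ^ Suc t * lyap (rr_b d) K (X r {v}) (real 0))"
      proof (rule act)
        have "touched d V r {v} \<subseteq> insert v (touched d V r Act)" by (auto simp: touched_def)
        then have "card (touched d V r {v}) \<le> card (insert v (touched d V r Act))"
          using fin by (intro card_mono) (auto simp: touched_def)
        also have "\<dots> \<le> Suc (card (touched d V r Act))" by (simp add: card_insert_le_m1 card_insert_if fin touched_def)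
        finally show "card (touched d V r {v}) + d + (d + 1) * t \<le> (d + 1) * T" using B by simp
      qed (use v rv d in auto)
      also have "\<dots> \<le> real (card (rgraphs V r)) * (\<rho> ^ Suc t * lyap (rr_b d) K (X r Act) s)"
        using \<rho> lyap_le_3[of 0 "rr_b d" K "X r {v}"] bK True
        by (intro mult_left_mono) (auto simp: lyap_0)
      finally show ?thesis .
    qed
  qed
  let ?G = "rgraphs {1..n} (\<lambda>_. d)"
  let ?S = "\<Sum>D\<in>?G. perc p D (\<lambda>E. cmax n E < K)"
  have "?S \<le> (\<Sum>D\<in>?G. perc p D (\<lambda>E. small K E {} 0))"
  proof (intro sum_mono perc_mono p01)
    fix D E assume "D \<in> ?G" "E \<subseteq> D" "cmax n E < K"
    then show "small K E {} 0"
      using n0 by (intro small_if_cmax_less[of n]) (auto simp: rgraphs_def all_edges_eq_pairs)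
  qed
  also have "\<dots> \<le> real (card ?G) * (\<rho> ^ T * lyap (rr_b d) K (X (\<lambda>_. d) {}) (real 0))"
    by (rule main) (auto simp: touched_def)
  also have "\<dots> \<le> real (card ?G) * (exp (- (rr_\<sigma> d / (6 * rr_b d) / K) * real T) * 3)"
    unfolding X_def \<rho>_def using one_minus_power_le_exp[OF \<kappa>, of T]
    by (intro mult_left_mono) (auto simp: lyap_0)
  finally have S: "?S \<le> real (card ?G) * (3 * exp (- (rr_\<sigma> d / (6 * rr_b d)) * real T / real K))"
    by simp
  have eq: "gndp_prob n d p (\<lambda>E. cmax n E < K) = ?S / real (card ?G)"
    unfolding gndp_prob_def regular_graphs_eq perc_def wt_def by simp
  show ?thesis
  \<comment> \<open>If no d-regular graph exists, division by zero makes the probability 0.\<close>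
  proof (cases "card ?G = 0")
    case True
    then show ?thesis unfolding eq by simp
  next
    case False
    then show ?thesis unfolding eq using S by (simp add: pos_divide_le_eq mult.commute)
  qed
qed

section \<open>The critical window\<close>

text \<open>The common choice of T for both models; f n \<theta> K stands for the probability that
  no component reaches K at 1 + \<theta> times the critical density. The constant c is fixed before
  lam, and n0 is uniform in a, so that a may later be taken as A n.\<close>

lemma near_critical_scaling:
  fixes f :: "nat \<Rightarrow> real \<Rightarrow> nat \<Rightarrow> real" and \<mu> C \<kappa> \<tau> :: real and n1 :: nat
  assumes pos: "\<mu> > 0" "C > 0" "\<kappa> > 0" "\<tau> > 0"
    and f: "\<And>n \<theta> K T. n1 \<le> n \<Longrightarrow> 1 \<le> K \<Longrightarrow> (\<bar>\<theta>\<bar> + C * real T / real n) * sqrt (real K) \<le> \<mu> \<Longrightarrow>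
      real K \<le> \<tau> * real n \<Longrightarrow> real T \<le> \<tau> * real n \<Longrightarrow> f n \<theta> K \<le> 3 * exp (- \<kappa> * real T / real K)"
  shows "\<exists>c>0. \<forall>lam::real. \<exists>A0>0. \<exists>n0. \<forall>n\<ge>n0. \<forall>a\<ge>A0. 1 \<le> real n powr (2/3) / a \<longrightarrow>
    f n (lam * real n powr (-1/3)) (nat \<lceil>real n powr (2/3) / a\<rceil>) \<le> exp (- c * a powr (3/2))"
proof -
  define \<epsilon> where "\<epsilon> = min (\<mu> / (2 * C)) \<tau>"
  have \<epsilon>: "\<epsilon> > 0" "\<epsilon> \<le> \<tau>" "C * \<epsilon> \<le> \<mu> / 2"
  proof -
    show "\<epsilon> > 0" "\<epsilon> \<le> \<tau>" using pos by (auto simp: \<epsilon>_def)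
    have "\<epsilon> \<le> \<mu> / (2 * C)" by (simp add: \<epsilon>_def)
    then show "C * \<epsilon> \<le> \<mu> / 2" using pos by (simp add: field_simps)
  qed
  \<comment> \<open>Below, T / K >= \<epsilon> a^(3/2) / 6, so the exponent is at least 2 c a^(3/2);
    half of it absorbs the prefactor 3.\<close>
  define c where "c = \<kappa> * \<epsilon> / 12"
  have c: "c > 0" using pos \<epsilon> by (simp add: c_def)
  have "\<exists>A0>0. \<exists>n0. \<forall>n\<ge>n0. \<forall>a\<ge>A0. 1 \<le> real n powr (2/3) / a \<longrightarrow>
    f n (lam * real n powr (-1/3)) (nat \<lceil>real n powr (2/3) / a\<rceil>) \<le> exp (- c * a powr (3/2))" for lam :: real
  proof -
    \<comment> \<open>The second term gives |\<theta>| sqrt K <= \<mu> / 2, because \<theta>^2 K <=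
      2 lam^2 / a. The third gives c a^(3/2) >= 2, hence exp (c a^(3/2)) >= 3.\<close>
    define A0 where "A0 = 1 + 8 * lam\<^sup>2 / \<mu>\<^sup>2 + 2 / c"
    \<comment> \<open>A lower bound for n^(1/3): 2 / \<tau> ensures K <= \<tau> n, and 3 /
      \<epsilon> makes \<epsilon> n / sqrt K at least 2, so that rounding down at most halves
      it.\<close>
    define Y where "Y = 1 + 2 / \<tau> + 3 / \<epsilon>"
    define n0 where "n0 = nat \<lceil>Y ^ 3\<rceil> + n1"
    have A0: "A0 \<ge> 1" "8 * lam\<^sup>2 / \<mu>\<^sup>2 \<le> A0" "2 / c \<le> A0" using c by (auto simp: A0_def)
    have Y: "Y \<ge> 1" "2 / \<tau> \<le> Y" "3 / \<epsilon> \<le> Y" using pos \<epsilon> by (auto simp: Y_def)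
    have "f n (lam * real n powr (-1/3)) (nat \<lceil>real n powr (2/3) / a\<rceil>) \<le> exp (- c * a powr (3/2))"
      if n: "n \<ge> n0" and a: "a \<ge> A0" and x1: "1 \<le> real n powr (2/3) / a" for n a
    proof -
      define y where "y = real n powr (1/3)"
      have nY: "real n \<ge> Y ^ 3" "n \<ge> n1" using n by (auto simp: n0_def) linarith
      have n_pos: "real n > 0" using nY Y by (smt (verit) one_le_power)
      have y3: "y ^ 3 = real n"
        using n_pos by (simp add: y_def powr_powr flip: powr_realpow)
      have y2: "real n powr (2/3) = y\<^sup>2"
        using n_pos by (simp add: y_def powr_powr flip: powr_realpow)
      have yi: "real n powr (-1/3) = 1 / y"
        using n_pos by (simp add: y_def powr_minus_divide flip: powr_minus)
      have y0: "y > 0" using n_pos by (simp add: y_def)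
      have yY: "y \<ge> Y"
        using nY y3 y0 Y power_mono_iff[of Y y 3] by simp
      have y: "y \<ge> 1" "2 / \<tau> \<le> y" "3 / \<epsilon> \<le> y" using yY Y by auto
      have a0: "a > 0" "a \<ge> 1" using a A0 by auto
      define x where "x = y\<^sup>2 / a"
      define K where "K = nat \<lceil>x\<rceil>"
      define T where "T = nat \<lfloor>\<epsilon> * real n / sqrt (real K)\<rfloor>"
      define \<theta> where "\<theta> = lam / y"
      have x: "x \<ge> 1" using x1 y2 by (simp add: x_def)
      have K: "K \<ge> 1" "real K \<ge> x" "real K \<le> 2 * x" using x unfolding K_def by linarith+
      have xy: "x \<le> y\<^sup>2" using a0 y0 by (simp add: x_def field_simps)
      have sK: "sqrt (real K) > 0" using K by simp
      have Tle: "real T \<le> \<epsilon> * real n / sqrt (real K)"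
        using \<epsilon> n_pos sK unfolding T_def by (simp add: of_nat_floor)
      have big: "\<epsilon> * real n / sqrt (real K) \<ge> 2"
      proof -
        have "\<epsilon> * y \<ge> 3" using y(3) \<epsilon> by (simp add: field_simps)
        have "2 * sqrt (real K) \<le> \<epsilon> * real n"
        proof (rule power2_le_imp_le)
          have "(2 * sqrt (real K))\<^sup>2 = 4 * real K" by (simp add: power_mult_distrib)
          also have "\<dots> \<le> 8 * y\<^sup>2" using K xy by simp
          also have "\<dots> \<le> 9 * (y\<^sup>2 * y\<^sup>2)"
          proof -
            have "1 \<le> y\<^sup>2" using y by simp
            then have "y\<^sup>2 * 1 \<le> y\<^sup>2 * y\<^sup>2" by (intro mult_left_mono) auto
            moreover have "0 \<le> y\<^sup>2" by simp
            ultimately show ?thesis by linarith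
          qed
          also have "\<dots> \<le> (\<epsilon> * y)\<^sup>2 * (y\<^sup>2 * y\<^sup>2)"
          proof (rule mult_right_mono)
            have "3\<^sup>2 \<le> (\<epsilon> * y)\<^sup>2" using \<open>\<epsilon> * y \<ge> 3\<close> by (intro power_mono) auto
            then show "9 \<le> (\<epsilon> * y)\<^sup>2" by simp
          qed simp
          also have "\<dots> = (\<epsilon> * real n)\<^sup>2"
            unfolding y3[symmetric] by (simp add: power2_eq_square power3_eq_cube)
          finally show "(2 * sqrt (real K))\<^sup>2 \<le> (\<epsilon> * real n)\<^sup>2" .
        qed (use \<epsilon> in simp)
        then show ?thesis using sK by (simp add: field_simps)
      qed
      have Tge: "real T \<ge> \<epsilon> * real n / sqrt (real K) / 2"
      proof -
        have half: "q / 2 \<le> t" if "q - 1 < t" "2 \<le> q" for q t :: real using that by linarith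
        have "\<epsilon> * real n / sqrt (real K) - 1 < real T" using big unfolding T_def by linarith
        from half[OF this big] show ?thesis .
      qed
      have drift: "(\<bar>\<theta>\<bar> + C * real T / real n) * sqrt (real K) \<le> \<mu>"
      proof -
        have "\<bar>\<theta>\<bar> * sqrt (real K) \<le> \<mu> / 2"
        proof (rule power2_le_imp_le)
          have "(\<bar>\<theta>\<bar> * sqrt (real K))\<^sup>2 = lam\<^sup>2 / y\<^sup>2 * real K"
            by (simp add: \<theta>_def power_mult_distrib power_divide)
          also have "\<dots> \<le> lam\<^sup>2 / y\<^sup>2 * (2 * x)" using K by (intro mult_left_mono) auto
          also have "\<dots> = 2 * lam\<^sup>2 / a" using y0 by (simp add: x_def)
          also have "\<dots> \<le> (\<mu> / 2)\<^sup>2"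
          proof -
            have "8 * lam\<^sup>2 / \<mu>\<^sup>2 \<le> a" using A0 a by linarith
            then show ?thesis using pos a0 by (simp add: field_simps power2_eq_square)
          qed
          finally show "(\<bar>\<theta>\<bar> * sqrt (real K))\<^sup>2 \<le> (\<mu> / 2)\<^sup>2" .
        qed (use pos in simp)
        moreover have "C * real T / real n * sqrt (real K) \<le> \<mu> / 2"
        proof -
          have "real T * sqrt (real K) \<le> \<epsilon> * real n" using Tle sK by (simp add: field_simps)
          then have "C * (real T * sqrt (real K)) / real n \<le> C * (\<epsilon> * real n) / real n"
            using pos n_pos by (intro divide_right_mono mult_left_mono) auto
          also have "\<dots> = C * \<epsilon>" using n_pos by simp
          also have "\<dots> \<le> \<mu> / 2" by (rule \<epsilon>(3))
          finally show ?thesis by (simp add: mult_ac)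
        qed
        ultimately show ?thesis unfolding distrib_right by linarith
      qed
      have K\<tau>: "real K \<le> \<tau> * real n"
      proof -
        have "2 \<le> \<tau> * y" using y(2) pos by (simp add: field_simps)
        then have "2 * y\<^sup>2 \<le> \<tau> * y * y\<^sup>2" by (intro mult_right_mono) auto
        also have "\<dots> = \<tau> * real n" unfolding y3[symmetric] by (simp add: power2_eq_square power3_eq_cube)
        finally show ?thesis using K xy by linarith
      qed
      have T\<tau>: "real T \<le> \<tau> * real n"
      proof -
        have "sqrt (real K) \<ge> 1" using K by simp
        then have "\<epsilon> * real n / sqrt (real K) \<le> \<epsilon> * real n / 1"
          using \<epsilon> n_pos by (intro divide_left_mono) auto
        also have "\<dots> \<le> \<tau> * real n" using \<epsilon> n_pos by simp
        finally show ?thesis using Tle by linarith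
      qed
      have apow: "a powr (3/2) = a * sqrt a"
      proof -
        have "a powr (3/2) = a powr (1 + 1/2)" by simp
        also have "\<dots> = a powr 1 * a powr (1/2)" by (rule powr_add)
        finally show ?thesis using a0 by (simp add: powr_half_sqrt)
      qed
      \<comment> \<open>Here x^(3/2) = n / a^(3/2). Rounding up to K costs a factor 2^(3/2) <= 3 and
        rounding down to T a factor 2, together 6.\<close>
      have exponent: "\<epsilon> * a powr (3/2) / 6 \<le> real T / real K"
      proof -
        have "real K * sqrt (real K) \<le> (2 * x) * sqrt (2 * x)"
          using K x by (intro mult_mono) auto
        also have "\<dots> = 2 * sqrt 2 * (x * sqrt x)" by (simp add: real_sqrt_mult)
        also have "\<dots> \<le> 3 * (x * sqrt x)"
        proof (rule mult_right_mono)
          have "sqrt 2 \<le> 3 / 2" by (rule real_le_lsqrt) (auto simp: power2_eq_square)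
          then show "2 * sqrt 2 \<le> 3" by simp
        qed (use x in simp)
        also have "x * sqrt x = real n / (a * sqrt a)"
        proof -
          have "sqrt x = y / sqrt a" using y0 by (simp add: x_def real_sqrt_divide)
          then show ?thesis unfolding y3[symmetric]
            by (simp add: x_def power2_eq_square power3_eq_cube)
        qed
        finally have "real K * sqrt (real K) * (a * sqrt a) \<le> 3 * real n"
          using a0 by (simp add: field_simps)
        then have "\<epsilon> * (real K * sqrt (real K) * (a * sqrt a)) \<le> \<epsilon> * (3 * real n)"
          using \<epsilon> by (intro mult_left_mono) auto
        then have "\<epsilon> * a powr (3/2) / 6 \<le> \<epsilon> * real n / sqrt (real K) / 2 / real K"
          unfolding apow using K sK by (simp add: field_simps)
        also have "\<dots> \<le> real T / real K" using Tge by (intro divide_right_mono) auto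
        finally show ?thesis .
      qed
      have "f n \<theta> K \<le> 3 * exp (- \<kappa> * real T / real K)"
        by (rule f[OF nY(2) K(1) drift K\<tau> T\<tau>])
      also have "\<dots> \<le> 3 * exp (- 2 * c * a powr (3/2))"
      proof -
        have "\<kappa> * (\<epsilon> * a powr (3/2) / 6) \<le> \<kappa> * (real T / real K)"
          using exponent pos by (intro mult_left_mono) auto
        then show ?thesis by (simp add: c_def mult_ac)
      qed
      also have "\<dots> \<le> exp (c * a powr (3/2)) * exp (- 2 * c * a powr (3/2))"
      proof (rule mult_right_mono)
        have "a * 1 \<le> a * sqrt a" using a0 by (intro mult_left_mono) auto
        then have "2 / c \<le> a powr (3/2)" unfolding apow using A0 a by linarith
        then have "2 \<le> c * a powr (3/2)" using c by (simp add: field_simps)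
        then show "3 \<le> exp (c * a powr (3/2))"
          using exp_ge_add_one_self[of "c * a powr (3/2)"] by linarith
      qed simp
      also have "\<dots> = exp (- c * a powr (3/2))" by (simp flip: exp_add)
      finally show ?thesis unfolding K_def x_def \<theta>_def y2 yi by simp
    qed
    then show ?thesis using A0(1) by (intro exI[of _ A0]) auto
  qed
  then show ?thesis using c by blast
qed


lemma sqrt_le_sqrtD:
  assumes "a * sqrt k \<le> sqrt b" "0 \<le> a" "0 \<le> k" "0 \<le> b"
  shows "a\<^sup>2 * k \<le> b"
proof -
  have "(a * sqrt k)\<^sup>2 \<le> (sqrt b)\<^sup>2" using assms by (intro power_mono) auto
  then show ?thesis using assms by (simp add: power_mult_distrib)
qed

lemma abs_le_if_mult_sqrt_le:
  fixes K :: nat and b :: real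
  assumes "(\<bar>\<theta>\<bar> + b) * sqrt (real K) \<le> \<mu>" "1 \<le> K" "0 \<le> b"
  shows "\<bar>\<theta>\<bar> \<le> \<mu>"
proof -
  have "\<bar>\<theta>\<bar> * 1 \<le> (\<bar>\<theta>\<bar> + b) * sqrt (real K)" using assms by (intro mult_mono) auto
  then show ?thesis using assms by simp
qed

text \<open>The entry 1/4 of \<mu> yields |\<theta>| <= 1/4 because K >= 1, the square root yields
  the squared drift condition, and \<tau> = 1/96 is 2 K / n <= 1/48.\<close>

lemma er_pointwise:
  "\<exists>c>0. \<forall>lam::real. \<exists>A0>0. \<exists>n0. \<forall>n\<ge>n0. \<forall>a\<ge>A0. 1 \<le> real n powr (2/3) / a \<longrightarrow>
    gnp_prob n ((1 + lam * real n powr (-1/3)) / real n) (\<lambda>E. cmax n E < nat \<lceil>real n powr (2/3) / a\<rceil>)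
      \<le> exp (- c * a powr (3/2))"
proof (rule near_critical_scaling[where f = "\<lambda>n \<theta> K. gnp_prob n ((1 + \<theta>) / real n) (\<lambda>E. cmax n E < K)"
      and \<mu> = "min (1/4) (sqrt (er_\<sigma> / 96))" and C = 2 and \<tau> = "1/96" and \<kappa> = "er_\<sigma> / (6 * er_b)" and ?n1.0 = 3])
  fix n K T :: nat and \<theta> :: real
  assume n: "3 \<le> n" and K: "1 \<le> K" and K\<tau>: "real K \<le> 1 / 96 * real n" and T\<tau>: "real T \<le> 1 / 96 * real n"
    and drift: "(\<bar>\<theta>\<bar> + 2 * real T / real n) * sqrt (real K) \<le> min (1/4) (sqrt (er_\<sigma> / 96))"
  have \<theta>: "\<bar>\<theta>\<bar> \<le> 1 / 4" using abs_le_if_mult_sqrt_le[OF drift K] by simp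
  show "gnp_prob n ((1 + \<theta>) / real n) (\<lambda>E. cmax n E < K) \<le> 3 * exp (- (er_\<sigma> / (6 * er_b)) * real T / real K)"
  proof (rule er_small_prob_le[OF n refl \<theta> K])
    show "T \<le> n" using T\<tau> by linarith
    show "(\<bar>\<theta>\<bar> + 2 * real T / real n)\<^sup>2 * real K \<le> er_\<sigma> / 96"
      using drift er_constants(1) by (intro sqrt_le_sqrtD) auto
    show "2 / real n * real K \<le> 1 / 48" using K\<tau> n by (simp add: field_simps)
  qed
qed (use er_constants in auto)

text \<open>The drift |\<theta>| d + 6 d (d + 1) T / n has a factor d, which is moved into \<mu>;
  this leaves C = 6 (d + 1).\<close>

lemma rr_pointwise:
  assumes d: "d \<ge> 3"
  shows "\<exists>c>0. \<forall>lam::real. \<exists>A0>0. \<exists>n0. \<forall>n\<ge>n0. \<forall>a\<ge>A0. 1 \<le> real n powr (2/3) / a \<longrightarrow>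
    gndp_prob n d ((1 + lam * real n powr (-1/3)) / (real d - 1)) (\<lambda>E. cmax n E < nat \<lceil>real n powr (2/3) / a\<rceil>)
      \<le> exp (- c * a powr (3/2))"
proof (rule near_critical_scaling[where f = "\<lambda>n \<theta> K. gndp_prob n d ((1 + \<theta>) / (real d - 1)) (\<lambda>E. cmax n E < K)"
      and \<mu> = "min (1/4) (sqrt (rr_\<sigma> d / 96) / real d)" and C = "6 * (real d + 1)"
      and \<tau> = "1 / (4 * (real d + 2))" and \<kappa> = "rr_\<sigma> d / (6 * rr_b d)" and ?n1.0 = "8 * (d + 1)"])
  have d1: "d \<ge> 1" using d by simp
  note const = rr_constants[OF d1]
  show "min (1/4) (sqrt (rr_\<sigma> d / 96) / real d) > 0" using const d by simp
  show "rr_\<sigma> d / (6 * rr_b d) > 0" using const by simp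
  fix n K T :: nat and \<theta> :: real
  assume n: "8 * (d + 1) \<le> n" and K: "1 \<le> K" and T\<tau>: "real T \<le> 1 / (4 * (real d + 2)) * real n"
    and drift: "(\<bar>\<theta>\<bar> + 6 * (real d + 1) * real T / real n) * sqrt (real K) \<le> min (1/4) (sqrt (rr_\<sigma> d / 96) / real d)"
  have \<theta>: "\<bar>\<theta>\<bar> \<le> 1 / 4" using abs_le_if_mult_sqrt_le[OF drift K] by simp
  show "gndp_prob n d ((1 + \<theta>) / (real d - 1)) (\<lambda>E. cmax n E < K)
    \<le> 3 * exp (- (rr_\<sigma> d / (6 * rr_b d)) * real T / real K)"
  proof (rule rr_small_prob_le[OF d refl \<theta> K n])
    have "real (4 * (d + 2) * T) \<le> real n" using T\<tau> by (simp add: field_simps)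
    then show "4 * (d + 2) * T \<le> n" by (simp only: of_nat_le_iff)
    show "(\<bar>\<theta>\<bar> * real d + 3 * (2 * real d * (real d + 1) * real T / real n))\<^sup>2 * real K \<le> rr_\<sigma> d / 96"
    proof (rule sqrt_le_sqrtD)
      have "(\<bar>\<theta>\<bar> * real d + 3 * (2 * real d * (real d + 1) * real T / real n)) * sqrt (real K)
        = real d * ((\<bar>\<theta>\<bar> + 6 * (real d + 1) * real T / real n) * sqrt (real K))"
        by (simp add: distrib_left distrib_right mult_ac)
      also have "\<dots> \<le> real d * (sqrt (rr_\<sigma> d / 96) / real d)"
        using drift by (intro mult_left_mono) auto
      also have "\<dots> = sqrt (rr_\<sigma> d / 96)" using d by simp
      finally show "(\<bar>\<theta>\<bar> * real d + 3 * (2 * real d * (real d + 1) * real T / real n)) * sqrt (real K)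
        \<le> sqrt (rr_\<sigma> d / 96)" .
    qed (use const in auto)
  qed
qed auto

text \<open>Rounding up turns the strict real bound into a strict bound by a natural number. For x <
  1, which the scaling excludes, the event is empty, since every component has a vertex.\<close>

lemma small_cmax_cases:
  assumes "n \<ge> 1"
  obtains "1 \<le> x" "(\<lambda>E. real (cmax n E) < x) = (\<lambda>E. cmax n E < nat \<lceil>x\<rceil>)"
    | "(\<lambda>E. real (cmax n E) < x) = (\<lambda>E. False)"
proof (cases "1 \<le> x")
  case True
  have "real m < x \<longleftrightarrow> m < nat \<lceil>x\<rceil>" for m :: nat by linarith
  with True show ?thesis by (intro that(1)) auto
next
  case False
  have "\<not> real (cmax n E) < x" for E
  proof -
    have "real 1 \<le> real (cmax n E)" using cmax_ge_1[OF assms, of E] by (simp only: of_nat_le_iff)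
    then show ?thesis using False by simp
  qed
  then show ?thesis by (intro that(2)) auto
qed

theorem theorem1:
  shows
  "(\<exists>c>0. \<forall>lam::real. \<exists>A0>0. \<forall>A :: nat \<Rightarrow> real.
      (\<forall>n. A0 \<le> A n) \<and> A \<in> o(\<lambda>n. real n powr (2/3)) \<longrightarrow>
      (\<forall>\<^sub>F n in at_top.
         gnp_prob n ((1 + lam * real n powr (-1/3)) / real n)
           (\<lambda>E. real (cmax n E) < real n powr (2/3) / A n)
         \<le> exp (- c * A n powr (3/2))))
   \<and>
   (\<forall>d::nat. d \<ge> 3 \<longrightarrow> (\<exists>c>0. \<forall>lam::real. \<exists>A0>0. \<forall>A :: nat \<Rightarrow> real.
      (\<forall>n. A0 \<le> A n) \<and> A \<in> O(\<lambda>n. real n powr (1/6)) \<longrightarrow>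
      (\<forall>\<^sub>F n in at_top. even (d * n) \<longrightarrow>
         gndp_prob n d ((1 + lam * real n powr (-1/3)) / (real d - 1))
           (\<lambda>E. real (cmax n E) < real n powr (2/3) / A n)
         \<le> exp (- c * A n powr (3/2)))))"
proof (intro conjI allI impI)
  from er_pointwise obtain c where c: "c > 0"
    and bound: "\<forall>lam::real. \<exists>A0>0. \<exists>n0. \<forall>n\<ge>n0. \<forall>a\<ge>A0. 1 \<le> real n powr (2/3) / a \<longrightarrow>
      gnp_prob n ((1 + lam * real n powr (-1/3)) / real n) (\<lambda>E. cmax n E < nat \<lceil>real n powr (2/3) / a\<rceil>)
        \<le> exp (- c * a powr (3/2))" by blast
  show "\<exists>c>0. \<forall>lam::real. \<exists>A0>0. \<forall>A :: nat \<Rightarrow> real.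
      (\<forall>n. A0 \<le> A n) \<and> A \<in> o(\<lambda>n. real n powr (2/3)) \<longrightarrow>
      (\<forall>\<^sub>F n in at_top.
         gnp_prob n ((1 + lam * real n powr (-1/3)) / real n)
           (\<lambda>E. real (cmax n E) < real n powr (2/3) / A n)
         \<le> exp (- c * A n powr (3/2)))"
  proof (rule exI[of _ c], rule conjI[OF c], rule allI)
    fix lam :: real
    from bound obtain A0 n0 where A0: "A0 > 0" and *: "\<And>n a. n \<ge> n0 \<Longrightarrow> a \<ge> A0 \<Longrightarrow> 1 \<le> real n powr (2/3) / a \<Longrightarrow>
      gnp_prob n ((1 + lam * real n powr (-1/3)) / real n) (\<lambda>E. cmax n E < nat \<lceil>real n powr (2/3) / a\<rceil>)
        \<le> exp (- c * a powr (3/2))" by blast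
    have "gnp_prob n ((1 + lam * real n powr (-1/3)) / real n) (\<lambda>E. real (cmax n E) < real n powr (2/3) / a)
        \<le> exp (- c * a powr (3/2))" if "n \<ge> max 1 n0" "a \<ge> A0" for n a
    proof -
      have "n \<ge> 1" using that by simp
      then show ?thesis
      proof (cases rule: small_cmax_cases[where x = "real n powr (2/3) / a"])
        case 1
        with *[of n a] that show ?thesis by simp
      next
        case 2
        then show ?thesis by (simp add: gnp_prob_def)
      qed
    qed
    then show "\<exists>A0>0. \<forall>A :: nat \<Rightarrow> real.
      (\<forall>n. A0 \<le> A n) \<and> A \<in> o(\<lambda>n. real n powr (2/3)) \<longrightarrow>
      (\<forall>\<^sub>F n in at_top.
         gnp_prob n ((1 + lam * real n powr (-1/3)) / real n)
           (\<lambda>E. real (cmax n E) < real n powr (2/3) / A n)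
         \<le> exp (- c * A n powr (3/2)))"
      using A0 by (intro exI[of _ A0] conjI allI impI eventually_at_top_linorderI[of "max 1 n0"]) auto
  qed
next
  fix d :: nat assume "d \<ge> 3"
  from rr_pointwise[OF this] obtain c where c: "c > 0"
    and bound: "\<forall>lam::real. \<exists>A0>0. \<exists>n0. \<forall>n\<ge>n0. \<forall>a\<ge>A0. 1 \<le> real n powr (2/3) / a \<longrightarrow>
      gndp_prob n d ((1 + lam * real n powr (-1/3)) / (real d - 1)) (\<lambda>E. cmax n E < nat \<lceil>real n powr (2/3) / a\<rceil>)
        \<le> exp (- c * a powr (3/2))" by blast
  show "\<exists>c>0. \<forall>lam::real. \<exists>A0>0. \<forall>A :: nat \<Rightarrow> real.
      (\<forall>n. A0 \<le> A n) \<and> A \<in> O(\<lambda>n. real n powr (1/6)) \<longrightarrow>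
      (\<forall>\<^sub>F n in at_top. even (d * n) \<longrightarrow>
         gndp_prob n d ((1 + lam * real n powr (-1/3)) / (real d - 1))
           (\<lambda>E. real (cmax n E) < real n powr (2/3) / A n)
         \<le> exp (- c * A n powr (3/2)))"
  proof (rule exI[of _ c], rule conjI[OF c], rule allI)
    fix lam :: real
    from bound obtain A0 n0 where A0: "A0 > 0" and *: "\<And>n a. n \<ge> n0 \<Longrightarrow> a \<ge> A0 \<Longrightarrow> 1 \<le> real n powr (2/3) / a \<Longrightarrow>
      gndp_prob n d ((1 + lam * real n powr (-1/3)) / (real d - 1)) (\<lambda>E. cmax n E < nat \<lceil>real n powr (2/3) / a\<rceil>)
        \<le> exp (- c * a powr (3/2))" by blast
    have "gndp_prob n d ((1 + lam * real n powr (-1/3)) / (real d - 1)) (\<lambda>E. real (cmax n E) < real n powr (2/3) / a)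
        \<le> exp (- c * a powr (3/2))" if "n \<ge> max 1 n0" "a \<ge> A0" for n a
    proof -
      have "n \<ge> 1" using that by simp
      then show ?thesis
      proof (cases rule: small_cmax_cases[where x = "real n powr (2/3) / a"])
        case 1
        with *[of n a] that show ?thesis by simp
      next
        case 2
        then show ?thesis by (simp add: gndp_prob_def)
      qed
    qed
    then show "\<exists>A0>0. \<forall>A :: nat \<Rightarrow> real.
      (\<forall>n. A0 \<le> A n) \<and> A \<in> O(\<lambda>n. real n powr (1/6)) \<longrightarrow>
      (\<forall>\<^sub>F n in at_top. even (d * n) \<longrightarrow>
         gndp_prob n d ((1 + lam * real n powr (-1/3)) / (real d - 1))
           (\<lambda>E. real (cmax n E) < real n powr (2/3) / A n)
         \<le> exp (- c * A n powr (3/2)))"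
      using A0 by (intro exI[of _ A0] conjI allI impI eventually_at_top_linorderI[of "max 1 n0"]) auto
  qed
qed

end
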